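(* Let $b\ge2$ be an integer. There are constants $C,c>0$ depending only on $b$ such that for all $\lambda,\beta>0$, all integers $n\ge1$ and all $\tau_1,\tau_2\in[b]^n$, with $\mathscr H_{\lambda,\beta}(\phi)=\lambda\cosh(\sqrt\beta\,\phi)$, $$\Bigl|\mathcal M_{b,n}^{\mathscr H_{\lambda,\beta}}\bigl[\phi_{\tau_1}\phi_{\tau_2}\bigr]\Bigr|\le C\exp\Bigl(-c\,\mathbf d(\tau_1,\tau_2)+C\log_+\frac1{\lambda\beta}\Bigr),$$ where $\log_+x=\max\{0,\log x\}$.
   Context: $[b]=\{1,\dots,b\}$, and $\mathcal T_{b,n}=\bigcup_{k=0}^n[b]^k$ is the set of strings over $[b]$ of length at most $n$ ($[b]^0=\{\varnothing\}$). $|\tau|$ denotes the length of $\tau$; $\tau'\preceq\tau$ means $\tau'$ is a prefix of $\tau$ (possibly $\tau'=\tau$). Branching random walk (BRW): let $(\zeta_\tau)_{\tau\in\mathcal T_{b,n}\setminus\{\varnothing\}}$ be independent standard Gaussians and $\phi_\tau=\sum_{\varnothing\ne\tau'\preceq\tau}\zeta_{\tau'}$. Let $\mathcal M_{b,n}^0$ be the law on $\mathbb R^{[b]^n}$ of the endpoints $\Phi=(\phi_\tau)_{\tau\in[b]^n}$. Tilted measure: for a convex function $\mathscr H:\mathbb R\to\mathbb R\cup\{\infty\}$, $\mathcal M_{b,n}^{\mathscr H}$ is the probability measure on $\mathbb R^{[b]^n}$ with $\frac{d\mathcal M_{b,n}^{\mathscr H}}{d\mathcal M_{b,n}^0}(\Phi)\propto\exp\bigl(-\sum_{\tau\in[b]^n}\mathscr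 H(\phi_\tau)\bigr)$. The notation $\mathcal M_{b,n}^{\mathscr H}[F(\Phi)]$ denotes the expectation of $F(\Phi)$ for $\Phi\sim\mathcal M_{b,n}^{\mathscr H}$. Distance: for $\tau_1,\tau_2\in[b]^n$, $\mathbf d(\tau_1,\tau_2)=n-|\tau'|$ where $\tau'$ is the longest common prefix of $\tau_1$ and $\tau_2$. *)

theory Defs
  imports "HOL-Probability.Probability" "HOL-Library.Sublist"
begin

definition leaves :: "nat \<Rightarrow> nat \<Rightarrow> nat list set" where
  "leaves b n = {\<tau>. set \<tau> \<subseteq> {1..b} \<and> length \<tau> = n}"

definition tree :: "nat \<Rightarrow> nat \<Rightarrow> nat list set" where
  "tree b n = (\<Union>k\<in>{0..n}. leaves b k)"

text \<open>Joint law of the independent standard Gaussian increments.\<close>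

definition increments :: "nat \<Rightarrow> nat \<Rightarrow> (nat list \<Rightarrow> real) measure" where
  "increments b n = (\<Pi>\<^sub>M \<tau>\<in>tree b n - {[]}. density lborel std_normal_density)"

definition brw_value :: "(nat list \<Rightarrow> real) \<Rightarrow> nat list \<Rightarrow> real" where
  "brw_value \<zeta> \<tau> = (\<Sum>\<tau>' | \<tau>' \<noteq> [] \<and> prefix \<tau>' \<tau>. \<zeta> \<tau>')"

definition brw_law :: "nat \<Rightarrow> nat \<Rightarrow> (nat list \<Rightarrow> real) measure" where
  "brw_law b n = distr (increments b n) (\<Pi>\<^sub>M \<tau>\<in>leaves b n. borel)
     (\<lambda>\<zeta>. \<lambda>\<tau>\<in>leaves b n. brw_value \<zeta> \<tau>)"

text \<open>The exponential of \<open>- x\<close>, extended continuously; an infinite potential has weight 0.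
  The value at \<open>-\<infinity>\<close> is irrelevant, since potentials take values in \<open>(-\<infinity>, \<infinity>]\<close>.\<close>

definition exp_neg :: "ereal \<Rightarrow> ennreal" where
  "exp_neg x = (case x of ereal r \<Rightarrow> ennreal (exp (- r)) | PInfty \<Rightarrow> 0 | MInfty \<Rightarrow> \<top>)"

definition boltzmann_weight ::
    "nat \<Rightarrow> nat \<Rightarrow> (real \<Rightarrow> ereal) \<Rightarrow> (nat list \<Rightarrow> real) \<Rightarrow> ennreal" where
  "boltzmann_weight b n H \<Phi> = exp_neg (\<Sum>\<tau>\<in>leaves b n. H (\<Phi> \<tau>))"

definition tilted_law ::
    "nat \<Rightarrow> nat \<Rightarrow> (real \<Rightarrow> ereal) \<Rightarrow> (nat list \<Rightarrow> real) measure" where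
  "tilted_law b n H = density (brw_law b n)
     (\<lambda>\<Phi>. boltzmann_weight b n H \<Phi> / (\<integral>\<^sup>+\<Psi>. boltzmann_weight b n H \<Psi> \<partial>brw_law b n))"

definition cosh_potential :: "real \<Rightarrow> real \<Rightarrow> real \<Rightarrow> ereal" where
  "cosh_potential l \<beta> \<phi> = ereal (l * cosh (sqrt \<beta> * \<phi>))"

definition tree_dist :: "nat \<Rightarrow> nat list \<Rightarrow> nat list \<Rightarrow> nat" where
  "tree_dist n \<tau>1 \<tau>2 = n - length (longest_common_prefix \<tau>1 \<tau>2)"

definition log_plus :: "real \<Rightarrow> real" where
  "log_plus x = max 0 (ln x)"

text \<open>The tilted law with the cosh potential is a probability measure, and the two-point
  functions are integrable, so the Bochner integral is the true expectation.\<close>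

lemma finite_leaves: "finite (leaves b n)"
  unfolding leaves_def using finite_lists_length_eq[of "{1..b}" n] by simp

lemma finite_tree: "finite (tree b n)"
  unfolding tree_def by (simp add: finite_leaves)

lemma prefix_in_tree:
  assumes "\<tau> \<in> leaves b n" "\<tau>' \<noteq> []" "prefix \<tau>' \<tau>"
  shows "\<tau>' \<in> tree b n - {[]}"
  using assms set_mono_prefix[of \<tau>' \<tau>] prefix_length_le[of \<tau>' \<tau>]
  by (auto simp: tree_def leaves_def)

lemma brw_value_measurable:
  assumes "\<tau> \<in> leaves b n"
  shows "(\<lambda>\<zeta>. brw_value \<zeta> \<tau>) \<in> borel_measurable (increments b n)"
  unfolding brw_value_def increments_def
proof (rule borel_measurable_sum)
  fix \<tau>' assume "\<tau>' \<in> {\<tau>'. \<tau>' \<noteq> [] \<and> prefix \<tau>' \<tau>}"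
  hence "\<tau>' \<in> tree b n - {[]}" using prefix_in_tree[OF assms] by auto
  from measurable_component_singleton[OF this, of "\<lambda>_. density lborel std_normal_density"]
  show "(\<lambda>\<zeta>. \<zeta> \<tau>') \<in> borel_measurable
      (\<Pi>\<^sub>M \<tau>\<in>tree b n - {[]}. density lborel std_normal_density)"
    by (simp cong: measurable_cong_sets)
qed

lemma brw_map_measurable:
  "(\<lambda>\<zeta>. \<lambda>\<tau>\<in>leaves b n. brw_value \<zeta> \<tau>)
     \<in> increments b n \<rightarrow>\<^sub>M (\<Pi>\<^sub>M \<tau>\<in>leaves b n. borel)"
  by (intro measurable_restrict brw_value_measurable)

lemma prob_space_increments: "prob_space (increments b n)"
  unfolding increments_def
  by (intro prob_space_PiM prob_space_normal_density) simp

lemma prob_space_brw_law: "prob_space (brw_law b n)"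
  unfolding brw_law_def
  by (intro prob_space.prob_space_distr prob_space_increments brw_map_measurable)

lemma sets_brw_law: "sets (brw_law b n) = sets (\<Pi>\<^sub>M \<tau>\<in>leaves b n. borel)"
  by (simp add: brw_law_def)

lemma component_measurable:
  assumes "\<tau> \<in> leaves b n"
  shows "(\<lambda>\<Phi>. \<Phi> \<tau>) \<in> borel_measurable (brw_law b n)"
  using measurable_component_singleton[OF assms, of "\<lambda>_. borel"]
  by (simp add: brw_law_def)

lemma boltzmann_weight_cosh:
  "boltzmann_weight b n (cosh_potential l \<beta>) \<Phi>
     = ennreal (exp (- (\<Sum>\<tau>\<in>leaves b n. l * cosh (sqrt \<beta> * \<Phi> \<tau>))))"
  by (simp add: boltzmann_weight_def cosh_potential_def exp_neg_def)

lemma boltzmann_weight_cosh_measurable: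
  "boltzmann_weight b n (cosh_potential l \<beta>) \<in> borel_measurable (brw_law b n)"
proof -
  have [measurable]: "(\<lambda>\<Phi>. \<Phi> \<tau>) \<in> borel_measurable (brw_law b n)" if "\<tau> \<in> leaves b n" for \<tau>
    using component_measurable[OF that] .
  have [measurable]: "(cosh :: real \<Rightarrow> real) \<in> borel_measurable borel"
    by (intro borel_measurable_continuous_onI continuous_intros)
  show ?thesis unfolding boltzmann_weight_cosh by measurable
qed

lemma partition_function_cosh:
  fixes b n :: nat and l \<beta> :: real
  assumes "l > 0"
  defines "Z \<equiv> (\<integral>\<^sup>+\<Psi>. boltzmann_weight b n (cosh_potential l \<beta>) \<Psi> \<partial>brw_law b n)"
  shows "Z \<noteq> 0" "Z \<noteq> \<infinity>"
proof -
  interpret prob_space "brw_law b n" by (rule prob_space_brw_law)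
  have le1: "boltzmann_weight b n (cosh_potential l \<beta>) \<Psi> \<le> 1" for \<Psi>
    using assms(1) by (auto simp: boltzmann_weight_cosh intro!: sum_nonneg)
  have "Z \<le> (\<integral>\<^sup>+\<Psi>. 1 \<partial>brw_law b n)"
    unfolding Z_def by (intro nn_integral_mono le1)
  also have "\<dots> = 1" by (simp add: emeasure_space_1)
  finally show "Z \<noteq> \<infinity>" by (auto simp: top_unique)
  show "Z \<noteq> 0"
  proof
    assume "Z = 0"
    hence "AE \<Psi> in brw_law b n. boltzmann_weight b n (cosh_potential l \<beta>) \<Psi> = 0"
      unfolding Z_def by (simp add: nn_integral_0_iff_AE boltzmann_weight_cosh_measurable)
    hence "AE \<Psi> in brw_law b n. False"
      by (auto simp: boltzmann_weight_cosh)
    thus False by simp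
  qed
qed

lemma prob_space_tilted_law_cosh:
  assumes "l > 0"
  shows "prob_space (tilted_law b n (cosh_potential l \<beta>))"
proof (rule prob_spaceI)
  let ?w = "boltzmann_weight b n (cosh_potential l \<beta>)"
  let ?Z = "\<integral>\<^sup>+\<Psi>. ?w \<Psi> \<partial>brw_law b n"
  have m: "(\<lambda>\<Phi>. ?w \<Phi> / ?Z) \<in> borel_measurable (brw_law b n)"
    using boltzmann_weight_cosh_measurable[of b n l \<beta>] by measurable
  have "emeasure (tilted_law b n (cosh_potential l \<beta>)) (space (brw_law b n))
      = (\<integral>\<^sup>+\<Phi>. ?w \<Phi> / ?Z * indicator (space (brw_law b n)) \<Phi> \<partial>brw_law b n)"
    unfolding tilted_law_def by (intro emeasure_density m) simp
  also have "\<dots> = (\<integral>\<^sup>+\<Phi>. ?w \<Phi> / ?Z \<partial>brw_law b n)"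
    by (intro nn_integral_cong) simp
  also have "\<dots> = ?Z / ?Z"
    by (rule nn_integral_divide[OF boltzmann_weight_cosh_measurable])
  also have "\<dots> = 1"
    using partition_function_cosh[OF assms, of b n \<beta>] by (simp add: ennreal_divide_self top.not_eq_extremum)
  finally show "emeasure (tilted_law b n (cosh_potential l \<beta>))
      (space (tilted_law b n (cosh_potential l \<beta>))) = 1"
    by (simp add: tilted_law_def)
qed

lemma cosh_ge_quadratic: "x\<^sup>2 / 4 \<le> cosh x" for x :: real
proof -
  have "y\<^sup>2 / 4 \<le> cosh y" if "y \<ge> 0" for y :: real
  proof -
    have "y\<^sup>2 / 2 \<le> exp y" using exp_lower_Taylor_quadratic[OF that] that by linarith
    also have "\<dots> \<le> exp y + exp (- y)" by simp
    finally show ?thesis by (simp add: cosh_field_def)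
  qed
  from this[of "\<bar>x\<bar>"] show ?thesis by simp
qed

lemma boltzmann_weight_square_bound:
  fixes \<Phi> :: "nat list \<Rightarrow> real"
  assumes "l > 0" "\<beta> > 0" "\<tau> \<in> leaves b n"
  shows "exp (- (\<Sum>\<tau>\<in>leaves b n. l * cosh (sqrt \<beta> * \<Phi> \<tau>))) * (\<Phi> \<tau>)\<^sup>2 \<le> 4 / (l * \<beta>)"
proof -
  define S where "S = (\<Sum>\<tau>\<in>leaves b n. l * cosh (sqrt \<beta> * \<Phi> \<tau>))"
  have "l * ((sqrt \<beta> * \<Phi> \<tau>)\<^sup>2 / 4) \<le> l * cosh (sqrt \<beta> * \<Phi> \<tau>)"
    using assms(1) by (intro mult_left_mono cosh_ge_quadratic) simp
  also have "\<dots> \<le> S"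
    unfolding S_def using assms
    by (intro member_le_sum) (auto simp: finite_leaves)
  also have "S \<le> exp S" using exp_ge_add_one_self[of S] by linarith
  finally have "l * \<beta> * (\<Phi> \<tau>)\<^sup>2 \<le> 4 * exp S"
    using assms by (simp add: power_mult_distrib)
  thus ?thesis using assms
    unfolding S_def[symmetric] by (simp add: exp_minus field_simps)
qed

lemma integrable_two_point_cosh:
  assumes "l > 0" "\<beta> > 0" "\<tau>1 \<in> leaves b n" "\<tau>2 \<in> leaves b n"
  shows "integrable (tilted_law b n (cosh_potential l \<beta>)) (\<lambda>\<Phi>. \<Phi> \<tau>1 * \<Phi> \<tau>2)"
proof (rule integrableI_bounded)
  let ?w = "boltzmann_weight b n (cosh_potential l \<beta>)"
  let ?Z = "\<integral>\<^sup>+\<Psi>. ?w \<Psi> \<partial>brw_law b n"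
  interpret prob_space "brw_law b n" by (rule prob_space_brw_law)
  have f: "(\<lambda>\<Phi>. \<Phi> \<tau>1 * \<Phi> \<tau>2) \<in> borel_measurable (brw_law b n)"
    using assms(3,4) by (intro borel_measurable_times component_measurable)
  thus "(\<lambda>\<Phi>. \<Phi> \<tau>1 * \<Phi> \<tau>2) \<in> borel_measurable (tilted_law b n (cosh_potential l \<beta>))"
    by (simp add: tilted_law_def)
  have m: "(\<lambda>\<Phi>. ?w \<Phi> / ?Z) \<in> borel_measurable (brw_law b n)"
    using boltzmann_weight_cosh_measurable[of b n l \<beta>] by measurable
  have bound: "?w \<Phi> * ennreal (norm (\<Phi> \<tau>1 * \<Phi> \<tau>2)) \<le> ennreal (4 / (l * \<beta>))" for \<Phi>
  proof -
    define e where "e = exp (- (\<Sum>\<tau>\<in>leaves b n. l * cosh (sqrt \<beta> * \<Phi> \<tau>)))"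
    have e: "e \<ge> 0" by (simp add: e_def)
    have "\<bar>\<Phi> \<tau>1 * \<Phi> \<tau>2\<bar> \<le> ((\<Phi> \<tau>1)\<^sup>2 + (\<Phi> \<tau>2)\<^sup>2) / 2"
      using sum_squares_bound[of "\<bar>\<Phi> \<tau>1\<bar>" "\<bar>\<Phi> \<tau>2\<bar>"] by (simp add: abs_mult)
    hence "e * \<bar>\<Phi> \<tau>1 * \<Phi> \<tau>2\<bar> \<le> e * (((\<Phi> \<tau>1)\<^sup>2 + (\<Phi> \<tau>2)\<^sup>2) / 2)"
      using e by (rule mult_left_mono)
    also have "\<dots> = (e * (\<Phi> \<tau>1)\<^sup>2 + e * (\<Phi> \<tau>2)\<^sup>2) / 2" by (simp add: algebra_simps)
    also have "\<dots> \<le> (4 / (l * \<beta>) + 4 / (l * \<beta>)) / 2"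
      using boltzmann_weight_square_bound[OF assms(1,2,3), of \<Phi>]
        boltzmann_weight_square_bound[OF assms(1,2,4), of \<Phi>]
      unfolding e_def by (intro divide_right_mono add_mono) auto
    also have "\<dots> = 4 / (l * \<beta>)" by simp
    finally show ?thesis
      using e by (simp add: boltzmann_weight_cosh e_def[symmetric] ennreal_mult[symmetric] ennreal_leI)
  qed
  have "(\<integral>\<^sup>+\<Phi>. ennreal (norm (\<Phi> \<tau>1 * \<Phi> \<tau>2)) \<partial>tilted_law b n (cosh_potential l \<beta>))
      = (\<integral>\<^sup>+\<Phi>. ?w \<Phi> / ?Z * ennreal (norm (\<Phi> \<tau>1 * \<Phi> \<tau>2)) \<partial>brw_law b n)"
    unfolding tilted_law_def
    by (intro nn_integral_density m measurable_compose[OF measurable_compose[OF f borel_measurable_norm] measurable_ennreal])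
  also have "\<dots> \<le> (\<integral>\<^sup>+\<Phi>. ennreal (4 / (l * \<beta>)) / ?Z \<partial>brw_law b n)"
  proof (rule nn_integral_mono)
    fix \<Phi>
    have "?w \<Phi> / ?Z * ennreal (norm (\<Phi> \<tau>1 * \<Phi> \<tau>2))
        = ?w \<Phi> * ennreal (norm (\<Phi> \<tau>1 * \<Phi> \<tau>2)) / ?Z"
      by (simp add: ennreal_times_divide mult.commute)
    also have "\<dots> \<le> ennreal (4 / (l * \<beta>)) / ?Z"
      by (intro divide_right_mono_ennreal bound)
    finally show "?w \<Phi> / ?Z * ennreal (norm (\<Phi> \<tau>1 * \<Phi> \<tau>2)) \<le> ennreal (4 / (l * \<beta>)) / ?Z" .
  qed
  also have "\<dots> = ennreal (4 / (l * \<beta>)) / ?Z" by (simp add: emeasure_space_1)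
  also have "\<dots> < \<infinity>"
    using partition_function_cosh[OF assms(1), of b n \<beta>]
    by (auto simp: ennreal_divide_eq_top_iff less_top[symmetric])
  finally show "(\<integral>\<^sup>+\<Phi>. ennreal (norm (\<Phi> \<tau>1 * \<Phi> \<tau>2))
      \<partial>tilted_law b n (cosh_potential l \<beta>)) < \<infinity>" .
qed

end

theory Submission
  imports Defs
begin

text \<open>
  Integrating out the last generation of the tree turns a measure with single-site weight
  \<open>\<rho> = exp (- H)\<close> at the leaves into one on a tree of depth one less, with weight
  \<open>(E \<rho> (x + \<zeta>)) ^ b\<close>. If \<open>H\<close> is even and \<open>H'' \<ge> m\<close>, the new potential is even with second
  derivative at least \<open>b m / (1 + m)\<close>, so starting from \<open>min (\<lambda> \<beta>) 1 \<le> b - 1\<close> the constant never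
  decreases. An observable \<open>f\<close> of a single leaf is replaced by its conditional mean given the
  parent, and this divides the Lipschitz constant by \<open>1 + m\<close>. Over \<open>d\<close> generations the product of
  the factors \<open>1 / (1 + m\<^sub>k) = m\<^sub>k\<^sub>+\<^sub>1 / (b m\<^sub>k)\<close> telescopes to \<open>m\<^sub>d / (b ^ d m\<^sub>0)\<close>. Two leaves at distance
  \<open>d\<close> evolve separately for \<open>d\<close> generations, after which one is left with a product of two odd
  Lipschitz functions of one variable \<open>\<phi>\<close>, controlled by \<open>E \<phi>\<^sup>2 \<le> 1 / m\<^sub>0\<close>. All the one-dimensional
  inequalities follow from Chebyshev's association inequality applied to ratios of densities.
\<close>

section \<open>One-variable weights, observables and the Gaussian convolution\<close>

text \<open>Imposed on products of a weight with an observable: the observable may grow, but the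
  decay of the weight makes the product bounded and hence integrable against every unit-variance
  normal density.\<close>

definition bounded_borel :: "(real \<Rightarrow> real) \<Rightarrow> bool" where
  "bounded_borel h \<longleftrightarrow> h \<in> borel_measurable borel \<and> (\<exists>B. \<forall>x. \<bar>h x\<bar> \<le> B)"

text \<open>The heat semigroup at time one, that is, the mean of \<open>h (x + Z)\<close> for a
  standard normal \<open>Z\<close>. With \<open>x\<close> placed in the density, dependence on
  \<open>x\<close> can be studied through likelihood ratios instead of derivatives of
  \<open>h\<close>.\<close>

definition heat :: "(real \<Rightarrow> real) \<Rightarrow> real \<Rightarrow> real" where
  "heat h x = (\<integral>y. h y * normal_density x 1 y \<partial>lborel)"

text \<open>The conditional mean of \<open>f\<close> at a leaf with weight \<open>\<rho>\<close>,
  given the value \<open>x\<close> of its parent.\<close>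

definition tilted_mean :: "(real \<Rightarrow> real) \<Rightarrow> (real \<Rightarrow> real) \<Rightarrow> real \<Rightarrow> real" where
  "tilted_mean \<rho> f x = heat (\<lambda>y. \<rho> y * f y) x / heat \<rho> x"

text \<open>With \<open>\<rho> = exp (- H)\<close>, the last clause says that \<open>H x - m x\<^sup>2 / 2\<close> has nondecreasing
  increments; it is a convexity condition that does not mention derivatives.\<close>

definition even_log_concave :: "real \<Rightarrow> (real \<Rightarrow> real) \<Rightarrow> bool" where
  "even_log_concave m \<rho> \<longleftrightarrow> \<rho> \<in> borel_measurable borel \<and> (\<forall>x. 0 < \<rho> x) \<and> (\<forall>x. \<rho> (- x) = \<rho> x) \<and>
     (\<forall>x x' t. x \<le> x' \<longrightarrow> 0 \<le> t \<longrightarrow>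
        \<rho> (x' + t) * \<rho> x \<le> exp (- m * t * (x' - x)) * (\<rho> (x + t) * \<rho> x'))"

text \<open>A class preserved by \<open>tilted_mean\<close>, so that only the constant
  \<open>L\<close> has to be followed through the generations. Oddness gives \<open>f 0 = 0\<close>
  and with it linear growth.\<close>

definition odd_mono_lipschitz :: "real \<Rightarrow> (real \<Rightarrow> real) \<Rightarrow> bool" where
  "odd_mono_lipschitz L f \<longleftrightarrow> (\<forall>x. f (- x) = - f x) \<and>
     (\<forall>x y. x \<le> y \<longrightarrow> f x \<le> f y \<and> f y \<le> f x + L * (y - x))"

lemma normal_density_unit: "normal_density x 1 y = exp (- (y - x)\<^sup>2 / 2) / sqrt (2 * pi)"
  by (simp add: normal_density_def)

lemma integrable_bounded_borel_normal:
  assumes "bounded_borel h"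
  shows "integrable lborel (\<lambda>y. h y * normal_density x 1 y)"
proof -
  from assms obtain B where m[measurable]: "h \<in> borel_measurable borel" and B: "\<And>x. \<bar>h x\<bar> \<le> B"
    by (auto simp: bounded_borel_def)
  show ?thesis
  proof (rule Bochner_Integration.integrable_bound)
    show "integrable lborel (\<lambda>y. B * normal_density x 1 y)" by simp
    show "AE y in lborel. norm (h y * normal_density x 1 y) \<le> norm (B * normal_density x 1 y)"
    proof (intro AE_I2)
      fix y
      have "\<bar>h y\<bar> \<le> \<bar>B\<bar>" using B[of y] by linarith
      thus "norm (h y * normal_density x 1 y) \<le> norm (B * normal_density x 1 y)"
        by (simp add: abs_mult mult_right_mono)
    qed
  qed simp
qed

lemma bounded_borel_heat:
  assumes "bounded_borel h"
  shows "bounded_borel (heat h)"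
proof -
  from assms obtain B where m[measurable]: "h \<in> borel_measurable borel" and B: "\<And>x. \<bar>h x\<bar> \<le> B"
    by (auto simp: bounded_borel_def)
  have "\<bar>heat h x\<bar> \<le> B" for x
  proof -
    have "\<bar>heat h x\<bar> \<le> (\<integral>y. \<bar>h y * normal_density x 1 y\<bar> \<partial>lborel)"
      unfolding heat_def by (rule integral_abs_bound)
    also have "\<dots> \<le> (\<integral>y. B * normal_density x 1 y \<partial>lborel)"
      by (intro integral_mono integrable_abs integrable_bounded_borel_normal[OF assms])
        (auto simp: abs_mult intro!: mult_right_mono B)
    also have "\<dots> = B" by simp
    finally show ?thesis .
  qed
  moreover have "heat h \<in> borel_measurable borel"
    unfolding heat_def normal_density_def by measurable
  ultimately show ?thesis by (auto simp: bounded_borel_def)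
qed

lemma heat_pos:
  assumes "bounded_borel h" "\<And>x. 0 < h x"
  shows "0 < heat h x"
proof -
  have pos: "0 < h y * normal_density x 1 y" for y
    using assms(2) by (simp add: normal_density_pos)
  have "heat h x \<noteq> 0"
  proof
    assume "heat h x = 0"
    hence "AE y in lborel. h y * normal_density x 1 y = 0"
      unfolding heat_def using integrable_bounded_borel_normal[OF assms(1)] pos
      by (subst (asm) integral_nonneg_eq_0_iff_AE) (auto intro: less_imp_le)
    moreover have "(h y * normal_density x 1 y = 0) = False" for y using pos[of y] by (metis less_irrefl)
    ultimately have "AE y in (lborel :: real measure). False" by simp
    thus False by (simp add: AE_iff_null emeasure_lborel_UNIV null_sets_def)
  qed
  moreover have "0 \<le> heat h x"
    unfolding heat_def by (intro Bochner_Integration.integral_nonneg) (use pos in \<open>auto intro: less_imp_le\<close>)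
  ultimately show ?thesis by simp
qed

lemma heat_reflect: "heat h (- x) = heat (\<lambda>y. h (- y)) x"
proof -
  have "heat h (- x) = (\<integral>y. h (- y) * normal_density (- x) 1 (- y) \<partial>lborel)"
    unfolding heat_def by (subst lborel_integral_real_affine[where c = "-1" and t = 0]) auto
  also have "\<dots> = heat (\<lambda>y. h (- y)) x"
    by (simp add: heat_def normal_density_unit power2_commute)
  finally show ?thesis .
qed

lemma heat_std_normal: "(\<integral>z. h (x + z) \<partial>density lborel std_normal_density) = heat h x"
  if [measurable]: "h \<in> borel_measurable borel"
proof -
  have "(\<integral>z. h (x + z) \<partial>density lborel std_normal_density) = (\<integral>z. std_normal_density z * h (x + z) \<partial>lborel)"
    by (subst integral_density) auto
  also have "\<dots> = heat h x"
    unfolding heat_def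
    by (subst (2) lborel_integral_real_affine[where c = 1 and t = x])
       (auto simp: normal_density_unit mult.commute)
  finally show ?thesis .
qed

text \<open>For positive \<open>a\<close> and \<open>c\<close>, hypothesis \<open>le\<close> says
  that \<open>a / c\<close> and \<open>f\<close> are oppositely ordered, so the mean of
  \<open>f\<close> under \<open>a\<close> is at most its mean under \<open>c\<close>. The
  cross-multiplied form avoids division and suits unnormalised densities.\<close>

lemma chebyshev_integral:
  fixes f a c :: "real \<Rightarrow> real"
  assumes a: "integrable lborel a" and c: "integrable lborel c"
    and fa: "integrable lborel (\<lambda>y. f y * a y)" and fc: "integrable lborel (\<lambda>y. f y * c y)"
    and le: "\<And>y y'. (f y - f y') * (a y * c y' - a y' * c y) \<le> 0"
  shows "(\<integral>y. f y * a y \<partial>lborel) * (\<integral>y. c y \<partial>lborel)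
       \<le> (\<integral>y. f y * c y \<partial>lborel) * (\<integral>y. a y \<partial>lborel)"
proof -
  define A C FA FC where "A = (\<integral>y. a y \<partial>lborel)" "C = (\<integral>y. c y \<partial>lborel)"
    "FA = (\<integral>y. f y * a y \<partial>lborel)" "FC = (\<integral>y. f y * c y \<partial>lborel)"
  note d = this
  \<comment> \<open>The double integral of \<open>le\<close> is taken one variable at a time, here
    over \<open>y\<close> with \<open>y'\<close> fixed, so only single integrals occur.\<close>
  have inner: "FA * c y' - FC * a y' - f y' * c y' * A + f y' * a y' * C \<le> 0" for y'
  proof -
    have "FA * c y' - FC * a y' - f y' * c y' * A + f y' * a y' * C
        = (\<integral>y. f y * a y * c y' - f y * c y * a y' - f y' * c y' * a y + f y' * a y' * c y \<partial>lborel)"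
      unfolding d using a c fa fc by simp
    also have "\<dots> = (\<integral>y. (f y - f y') * (a y * c y' - a y' * c y) \<partial>lborel)"
      by (intro Bochner_Integration.integral_cong) (auto simp: algebra_simps)
    also have "\<dots> \<le> (\<integral>y. 0 \<partial>(lborel :: real measure))"
      by (rule integral_mono'[OF _ le]) auto
    finally show ?thesis by simp
  qed
  \<comment> \<open>Integrating over \<open>y'\<close> produces twice the wanted difference.\<close>
  have "FA * C - FC * A - FC * A + FA * C
      = (\<integral>y. FA * c y - FC * a y - f y * c y * A + f y * a y * C \<partial>lborel)"
    unfolding d using a c fa fc by simp
  also have "\<dots> \<le> (\<integral>y. 0 \<partial>(lborel :: real measure))"
    by (rule integral_mono'[OF _ inner]) auto
  finally have "FA * C \<le> FC * A" by (simp add: mult.commute)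
  thus ?thesis unfolding d .
qed

section \<open>Even strongly log-concave weights under Gaussian convolution\<close>

context
  fixes m :: real and \<rho> :: "real \<Rightarrow> real"
  assumes lc: "even_log_concave m \<rho>" and m: "m > 0"
begin

lemma elc_measurable [measurable]: "\<rho> \<in> borel_measurable borel"
  and elc_pos: "0 < \<rho> x"
  and elc_even: "\<rho> (- x) = \<rho> x"
  and elc_ineq: "x \<le> x' \<Longrightarrow> 0 \<le> t \<Longrightarrow>
     \<rho> (x' + t) * \<rho> x \<le> exp (- m * t * (x' - x)) * (\<rho> (x + t) * \<rho> x')"
  using lc unfolding even_log_concave_def by blast+

lemma elc_abs: "\<rho> \<bar>x\<bar> = \<rho> x"
  using elc_even[of x] by (cases "x \<ge> 0") (auto simp: abs_if)

text \<open>Take the points \<open>- \<bar>y\<bar>\<close> and \<open>\<bar>y'\<bar>\<close> with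
  shift \<open>\<bar>y\<bar> - \<bar>y'\<bar>\<close> in the defining inequality: evenness turns
  both sides into squares. Thus \<open>\<rho> y * exp (m * y\<^sup>2 / 2)\<close> is nonincreasing
  in \<open>\<bar>y\<bar>\<close>.\<close>

lemma elc_decay:
  assumes "\<bar>y'\<bar> \<le> \<bar>y\<bar>"
  shows "\<rho> y \<le> exp (- m * (y\<^sup>2 - y'\<^sup>2) / 2) * \<rho> y'"
proof -
  have "\<rho> \<bar>y\<bar> * \<rho> (- \<bar>y\<bar>)
      \<le> exp (- m * (\<bar>y\<bar> - \<bar>y'\<bar>) * (\<bar>y'\<bar> - (- \<bar>y\<bar>))) * (\<rho> (- \<bar>y'\<bar>) * \<rho> \<bar>y'\<bar>)"
    using elc_ineq[of "- \<bar>y\<bar>" "\<bar>y'\<bar>" "\<bar>y\<bar> - \<bar>y'\<bar>"] assms by simp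
  also have "- m * (\<bar>y\<bar> - \<bar>y'\<bar>) * (\<bar>y'\<bar> - (- \<bar>y\<bar>)) = 2 * (- m * (y\<^sup>2 - y'\<^sup>2) / 2)"
  proof -
    have "(\<bar>y\<bar> - \<bar>y'\<bar>) * (\<bar>y'\<bar> - (- \<bar>y\<bar>)) = \<bar>y\<bar>\<^sup>2 - \<bar>y'\<bar>\<^sup>2"
      by (simp add: power2_eq_square algebra_simps)
    thus ?thesis by simp
  qed
  finally have "(\<rho> y)\<^sup>2 \<le> exp (2 * (- m * (y\<^sup>2 - y'\<^sup>2) / 2)) * (\<rho> y')\<^sup>2"
    by (simp only: elc_even elc_abs power2_eq_square)
  hence "(\<rho> y)\<^sup>2 \<le> (exp (- m * (y\<^sup>2 - y'\<^sup>2) / 2) * \<rho> y')\<^sup>2"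
    by (simp only: power_mult_distrib exp_double)
  thus ?thesis using elc_pos[of y'] by (simp add: power2_le_iff_abs_le less_imp_le)
qed

text \<open>The Gaussian decay of \<open>\<rho>\<close> absorbs quadratic growth, since
  \<open>y\<^sup>2 * exp (- (m * y\<^sup>2 / 2))\<close> is at most \<open>2 / m\<close>.\<close>

lemma bounded_borel_elc_quadratic:
  assumes [measurable]: "q \<in> borel_measurable borel" and q: "\<And>y. \<bar>q y\<bar> \<le> A + B * y\<^sup>2"
    and AB: "0 \<le> A" "0 \<le> B"
  shows "bounded_borel (\<lambda>y. \<rho> y * q y)"
proof -
  have "\<bar>\<rho> y * q y\<bar> \<le> \<rho> 0 * (A + B * (2 / m))" for y
  proof -
    define e where "e = exp (- (m * y\<^sup>2 / 2))"
    have "m * y\<^sup>2 / 2 \<le> exp (m * y\<^sup>2 / 2)" using exp_ge_add_one_self[of "m * y\<^sup>2 / 2"] by linarith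
    hence e2: "e * y\<^sup>2 \<le> 2 / m" using m by (simp add: e_def exp_minus field_simps)
    have e1: "e \<le> 1" "0 \<le> e" using m by (auto simp: e_def)
    have "\<bar>\<rho> y * q y\<bar> = \<rho> y * \<bar>q y\<bar>" using elc_pos[of y] by (simp add: abs_mult)
    also have "\<dots> \<le> (e * \<rho> 0) * (A + B * y\<^sup>2)"
      using elc_decay[of 0 y] e1 elc_pos[of 0] q[of y] by (intro mult_mono) (auto simp: e_def)
    also have "\<dots> = \<rho> 0 * (e * A + B * (e * y\<^sup>2))" by (simp add: algebra_simps)
    also have "\<dots> \<le> \<rho> 0 * (A + B * (2 / m))"
      using e1 e2 AB elc_pos[of 0]
      by (intro mult_left_mono add_mono) (auto simp: mult_left_le_one_le intro!: mult_left_mono)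
    finally show ?thesis .
  qed
  thus ?thesis by (auto simp: bounded_borel_def)
qed

lemma bounded_borel_elc: "bounded_borel \<rho>"
  using bounded_borel_elc_quadratic[of "\<lambda>_. 1" 1 0] by simp

lemma heat_elc_pos: "0 < heat \<rho> x"
  by (rule heat_pos[OF bounded_borel_elc elc_pos])

lemma heat_elc_even: "heat \<rho> (- x) = heat \<rho> x"
  by (simp add: heat_reflect elc_even)

text \<open>The law tilted towards \<open>x'\<close> is stochastically dominated by the translate by \<open>\<delta>\<close> of the
  law tilted towards \<open>x\<close>, because the ratio of the two densities is monotone.\<close>

lemma heat_elc_dominated:
  fixes f :: "real \<Rightarrow> real"
  assumes x: "x \<le> x'" and f: "mono f" and \<delta>: "\<delta> = (x' - x) / (1 + m)"
    and i1: "integrable lborel (\<lambda>y. \<rho> y * f y * normal_density x' 1 y)"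
    and i2: "integrable lborel (\<lambda>y. \<rho> y * f (y + \<delta>) * normal_density x 1 y)"
  shows "heat (\<lambda>y. \<rho> y * f y) x' * heat \<rho> x \<le> heat (\<lambda>y. \<rho> y * f (y + \<delta>)) x * heat \<rho> x'"
proof -
  have \<delta>0: "\<delta> \<ge> 0" using x m by (simp add: \<delta>)
  \<comment> \<open>This relation dictates \<open>\<delta>\<close>: the factor
    \<open>exp (m * \<delta> * (y' - y))\<close> gained by the Gaussian ratio is exactly the one
    lost by \<open>\<rho>\<close> over the shift \<open>\<delta>\<close>.\<close>
  have \<delta>m: "x' - x - \<delta> = m * \<delta>" using m by (simp add: \<delta> field_simps)
  let ?a = "\<lambda>y. \<rho> y * normal_density x' 1 y"
  let ?c = "\<lambda>y. \<rho> (y - \<delta>) * normal_density x 1 (y - \<delta>)"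
  have ratio: "?a y' * ?c y \<le> ?a y * ?c y'" if "y \<le> y'" for y y'
  proof -
    have "\<rho> ((y' - \<delta>) + \<delta>) * \<rho> (y - \<delta>)
        \<le> exp (- m * \<delta> * ((y' - \<delta>) - (y - \<delta>))) * (\<rho> ((y - \<delta>) + \<delta>) * \<rho> (y' - \<delta>))"
      using that \<delta>0 by (intro elc_ineq) auto
    hence r: "\<rho> y' * \<rho> (y - \<delta>) \<le> exp (- m * \<delta> * (y' - y)) * (\<rho> y * \<rho> (y' - \<delta>))" by simp
    have n: "normal_density x' 1 y' * normal_density x 1 (y - \<delta>)
        = exp (m * \<delta> * (y' - y)) * (normal_density x' 1 y * normal_density x 1 (y' - \<delta>))"
    proof -
      have "- (y' - x')\<^sup>2 / 2 + - (y - \<delta> - x)\<^sup>2 / 2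
          = (x' - x - \<delta>) * (y' - y) + (- (y - x')\<^sup>2 / 2 + - (y' - \<delta> - x)\<^sup>2 / 2)"
        by (simp add: power2_eq_square field_simps)
      thus ?thesis unfolding \<delta>m by (simp add: normal_density_unit flip: exp_add)
    qed
    have "?a y' * ?c y = (\<rho> y' * \<rho> (y - \<delta>)) * (normal_density x' 1 y' * normal_density x 1 (y - \<delta>))"
      by simp
    also have "\<dots> \<le> (exp (- m * \<delta> * (y' - y)) * (\<rho> y * \<rho> (y' - \<delta>)))
        * (normal_density x' 1 y' * normal_density x 1 (y - \<delta>))"
      by (intro mult_right_mono r) auto
    also have "\<dots> = (exp (- m * \<delta> * (y' - y)) * exp (m * \<delta> * (y' - y))) * (?a y * ?c y')"
      unfolding n by (simp only: mult_ac)
    also have "\<dots> = ?a y * ?c y'" by (simp flip: exp_add)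
    finally show ?thesis .
  qed
  have le: "(f y - f y') * (?a y * ?c y' - ?a y' * ?c y) \<le> 0" for y y'
  proof (cases "y \<le> y'")
    case True
    thus ?thesis using ratio[OF True] monoD[OF f True] by (intro mult_nonpos_nonneg) auto
  next
    case False
    hence "y' \<le> y" by simp
    thus ?thesis using ratio[of y' y] monoD[OF f, of y' y] by (intro mult_nonneg_nonpos) auto
  qed
  have ia: "integrable lborel ?a" by (rule integrable_bounded_borel_normal[OF bounded_borel_elc])
  have ic: "integrable lborel ?c"
    using lborel_integrable_real_affine[OF integrable_bounded_borel_normal[OF bounded_borel_elc, of x],
        of 1 "- \<delta>"] by simp
  have ifa: "integrable lborel (\<lambda>y. f y * ?a y)" using i1 by (simp add: mult_ac)
  have ifc: "integrable lborel (\<lambda>y. f y * ?c y)"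
    using lborel_integrable_real_affine[OF i2, of 1 "- \<delta>"] by (simp add: mult_ac)
  have "(\<integral>y. f y * ?a y \<partial>lborel) * (\<integral>y. ?c y \<partial>lborel)
      \<le> (\<integral>y. f y * ?c y \<partial>lborel) * (\<integral>y. ?a y \<partial>lborel)"
    by (rule chebyshev_integral[OF ia ic ifa ifc le])
  also have "(\<integral>y. ?c y \<partial>lborel) = heat \<rho> x"
    unfolding heat_def by (subst (2) lborel_integral_real_affine[where c = 1 and t = "- \<delta>"]) auto
  also have "(\<integral>y. f y * ?c y \<partial>lborel) = heat (\<lambda>y. \<rho> y * f (y + \<delta>)) x"
    unfolding heat_def
    by (subst (2) lborel_integral_real_affine[where c = 1 and t = "- \<delta>"]) (auto simp: mult_ac)
  finally show ?thesis by (simp add: heat_def mult_ac)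
qed

text \<open>Monotone likelihood ratio: moving the centre of the Gaussian to the right multiplies the
  density by a nondecreasing function of \<open>y\<close>, which by association raises the mean of a
  nondecreasing \<open>f\<close>.\<close>

lemma heat_elc_mono:
  fixes f :: "real \<Rightarrow> real"
  assumes x: "x \<le> x'" and f: "mono f" and i: "bounded_borel (\<lambda>y. \<rho> y * f y)"
  shows "heat (\<lambda>y. \<rho> y * f y) x * heat \<rho> x' \<le> heat (\<lambda>y. \<rho> y * f y) x' * heat \<rho> x"
proof -
  let ?a = "\<lambda>y. \<rho> y * normal_density x 1 y"
  let ?c = "\<lambda>y. \<rho> y * normal_density x' 1 y"
  have ratio: "?a y' * ?c y \<le> ?a y * ?c y'" if "y \<le> y'" for y y'
  proof -
    have "normal_density x 1 y' * normal_density x' 1 y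
        \<le> normal_density x 1 y * normal_density x' 1 y'"
    proof -
      have "- (y' - x)\<^sup>2 / 2 + - (y - x')\<^sup>2 / 2
          = - ((x' - x) * (y' - y)) + (- (y - x)\<^sup>2 / 2 + - (y' - x')\<^sup>2 / 2)"
        by (simp add: power2_eq_square field_simps)
      moreover have "(x' - x) * (y' - y) \<ge> 0" using x that by simp
      ultimately have "- (y' - x)\<^sup>2 / 2 + - (y - x')\<^sup>2 / 2 \<le> - (y - x)\<^sup>2 / 2 + - (y' - x')\<^sup>2 / 2"
        by linarith
      hence "exp (- (y' - x)\<^sup>2 / 2) * exp (- (y - x')\<^sup>2 / 2)
          \<le> exp (- (y - x)\<^sup>2 / 2) * exp (- (y' - x')\<^sup>2 / 2)"
        unfolding exp_add[symmetric] by simp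
      thus ?thesis by (simp add: normal_density_unit divide_right_mono)
    qed
    hence "(\<rho> y * \<rho> y') * (normal_density x 1 y' * normal_density x' 1 y)
        \<le> (\<rho> y * \<rho> y') * (normal_density x 1 y * normal_density x' 1 y')"
      using elc_pos by (intro mult_left_mono) (auto simp: less_imp_le)
    thus ?thesis by (simp add: mult_ac)
  qed
  have le: "(f y - f y') * (?a y * ?c y' - ?a y' * ?c y) \<le> 0" for y y'
  proof (cases "y \<le> y'")
    case True
    thus ?thesis using ratio[OF True] monoD[OF f True] by (intro mult_nonpos_nonneg) auto
  next
    case False
    hence "y' \<le> y" by simp
    thus ?thesis using ratio[of y' y] monoD[OF f, of y' y] by (intro mult_nonneg_nonpos) auto
  qed
  have "(\<integral>y. f y * ?a y \<partial>lborel) * (\<integral>y. ?c y \<partial>lborel)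
      \<le> (\<integral>y. f y * ?c y \<partial>lborel) * (\<integral>y. ?a y \<partial>lborel)"
    using integrable_bounded_borel_normal[OF bounded_borel_elc] integrable_bounded_borel_normal[OF i]
    by (intro chebyshev_integral le) (auto simp: mult_ac)
  thus ?thesis by (simp add: heat_def mult_ac)
qed

text \<open>Up to the factor \<open>exp (- (x * t + t\<^sup>2 / 2))\<close>, the ratio
  \<open>heat \<rho> (x + t) / heat \<rho> x\<close> is the tilted mean of
  \<open>exp (t * y)\<close>. By domination that mean grows at most by
  \<open>exp (t * \<delta>)\<close> from \<open>x\<close> to \<open>x'\<close>, while the explicit
  factor contributes \<open>exp (- t * (x' - x))\<close>; the exponents add up to
  \<open>- (m / (1 + m)) * t * (x' - x)\<close>.\<close>

lemma even_log_concave_heat: "even_log_concave (m / (1 + m)) (heat \<rho>)"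
  unfolding even_log_concave_def
proof (intro conjI allI impI)
  show "heat \<rho> \<in> borel_measurable borel"
    using bounded_borel_heat[OF bounded_borel_elc] by (simp add: bounded_borel_def)
  show "0 < heat \<rho> x" for x by (rule heat_elc_pos)
  show "heat \<rho> (- x) = heat \<rho> x" for x by (rule heat_elc_even)
  fix x x' t :: real
  assume x: "x \<le> x'" and t: "0 \<le> t"
  let ?E = "\<lambda>x. heat (\<lambda>y. \<rho> y * exp (t * y)) x"
  \<comment> \<open>Completing the square: the factor \<open>exp (t * y)\<close> moves the centre of
    the Gaussian from \<open>x\<close> to \<open>x + t\<close>.\<close>
  have shift: "exp (t * y) * normal_density x 1 y = exp (x * t + t\<^sup>2 / 2) * normal_density (x + t) 1 y" for x y
  proof -
    have "t * y + - (y - x)\<^sup>2 / 2 = x * t + t\<^sup>2 / 2 + - (y - (x + t))\<^sup>2 / 2"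
      by (simp add: power2_eq_square field_simps)
    thus ?thesis by (simp add: normal_density_unit flip: exp_add)
  qed
  have int: "integrable lborel (\<lambda>y. \<rho> y * exp (t * y) * normal_density x 1 y)" for x
    using integrable_mult_right[OF integrable_bounded_borel_normal[OF bounded_borel_elc, of "x + t"],
        of "exp (x * t + t\<^sup>2 / 2)"]
    by (simp only: mult.assoc shift) (simp only: mult_ac)
  have E: "?E x = exp (x * t + t\<^sup>2 / 2) * heat \<rho> (x + t)" for x
  proof -
    have "?E x = (\<integral>y. exp (x * t + t\<^sup>2 / 2) * (\<rho> y * normal_density (x + t) 1 y) \<partial>lborel)"
      unfolding heat_def by (simp only: mult.assoc shift) (simp only: mult_ac)
    thus ?thesis by (simp add: heat_def)
  qed
  define \<delta> where "\<delta> = (x' - x) / (1 + m)"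
  have ed: "exp (t * (y + \<delta>)) = exp (t * \<delta>) * exp (t * y)" for y
    by (simp add: distrib_left flip: exp_add)
  have "?E x' * heat \<rho> x \<le> heat (\<lambda>y. \<rho> y * exp (t * (y + \<delta>))) x * heat \<rho> x'"
    using int[of x'] integrable_mult_right[OF int[of x], of "exp (t * \<delta>)"] t
    by (intro heat_elc_dominated[OF x _ \<delta>_def]) (auto simp: ed mult_ac intro!: monoI mult_right_mono)
  also have "heat (\<lambda>y. \<rho> y * exp (t * (y + \<delta>))) x = exp (t * \<delta>) * ?E x"
    unfolding heat_def ed by (subst integral_mult_right_zero[symmetric]) (simp add: mult_ac)
  finally have "exp (x' * t + t\<^sup>2 / 2) * (heat \<rho> (x' + t) * heat \<rho> x)
      \<le> exp (t * \<delta> + (x * t + t\<^sup>2 / 2)) * (heat \<rho> (x + t) * heat \<rho> x')"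
    unfolding E exp_add by (simp add: mult_ac)
  also have "t * \<delta> + (x * t + t\<^sup>2 / 2) = (x' * t + t\<^sup>2 / 2) + (- (m / (1 + m)) * t * (x' - x))"
  proof -
    have "\<delta> = (x' - x) - (m / (1 + m)) * (x' - x)" using m by (simp add: \<delta>_def field_simps)
    hence "t * \<delta> = t * ((x' - x) - (m / (1 + m)) * (x' - x))" by simp
    thus ?thesis by (simp add: algebra_simps)
  qed
  finally show "heat \<rho> (x' + t) * heat \<rho> x
      \<le> exp (- (m / (1 + m)) * t * (x' - x)) * (heat \<rho> (x + t) * heat \<rho> x')"
    unfolding exp_add by (simp add: mult.assoc)
qed

text \<open>Compare \<open>\<rho>\<close> with the pure Gaussian weight
  \<open>exp (- m * y\<^sup>2 / 2)\<close>. Their ratio is nonincreasing in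
  \<open>\<bar>y\<bar>\<close>, whereas \<open>y\<^sup>2\<close> is nondecreasing, so association
  bounds the second moment by that of the Gaussian with mean \<open>x / (1 + m)\<close> and variance
  \<open>1 / (1 + m)\<close>.\<close>

lemma heat_elc_second_moment:
  "heat (\<lambda>y. \<rho> y * y\<^sup>2) x \<le> (1 / (1 + m) + (x / (1 + m))\<^sup>2) * heat \<rho> x"
proof -
  let ?\<mu> = "x / (1 + m)" and ?\<sigma> = "1 / sqrt (1 + m)"
  let ?a = "\<lambda>y. \<rho> y * normal_density x 1 y"
  let ?c = "\<lambda>y. exp (- m * y\<^sup>2 / 2) * normal_density x 1 y"
  let ?K = "exp (- (m * x\<^sup>2 / (2 * (1 + m)))) / sqrt (1 + m)"
  have \<sigma>: "?\<sigma> > 0" "?\<sigma>\<^sup>2 = 1 / (1 + m)" using m by (auto simp: power_divide)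
  have c: "?c y = ?K * normal_density ?\<mu> ?\<sigma> y" for y
  proof -
    have "- m * y\<^sup>2 / 2 + - (y - x)\<^sup>2 / 2
        = - (m * x\<^sup>2 / (2 * (1 + m))) + - (y - ?\<mu>)\<^sup>2 / (2 * ?\<sigma>\<^sup>2)"
      using m unfolding \<sigma> by (simp add: power2_eq_square divide_simps) (simp add: algebra_simps)
    moreover have "sqrt (2 * pi * ?\<sigma>\<^sup>2) = sqrt (2 * pi) / sqrt (1 + m)"
      unfolding \<sigma> by (simp add: real_sqrt_divide)
    ultimately show ?thesis
      using m by (simp add: normal_density_def flip: exp_add)
  qed
  have moments: "has_bochner_integral lborel (\<lambda>y. normal_density ?\<mu> ?\<sigma> y * y\<^sup>2) (?\<sigma>\<^sup>2 + ?\<mu>\<^sup>2)"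
  proof -
    \<comment> \<open>Expanding \<open>y\<^sup>2\<close> around the mean leaves the variance, the
      first moment and the total mass.\<close>
    have "has_bochner_integral lborel (\<lambda>y. normal_density ?\<mu> ?\<sigma> y * (y - ?\<mu>)\<^sup>2
        + 2 * ?\<mu> * (normal_density ?\<mu> ?\<sigma> y * y) - ?\<mu>\<^sup>2 * normal_density ?\<mu> ?\<sigma> y) (?\<sigma>\<^sup>2 + 2 * ?\<mu> * ?\<mu> - ?\<mu>\<^sup>2 * 1)"
      using normal_moment_even[OF \<sigma>(1), of ?\<mu> 1] normal_moment_even[OF \<sigma>(1), of ?\<mu> 0]
      by (intro has_bochner_integral_diff has_bochner_integral_add has_bochner_integral_mult_right
          normal_moment_nz_1 \<sigma>) (simp_all add: numeral_2_eq_2)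
    thus ?thesis
      by (rule has_bochner_integral_cong[THEN iffD1, rotated -1])
         (auto simp: power2_eq_square algebra_simps)
  qed
  have decay: "exp (- m * y'\<^sup>2 / 2) * \<rho> y \<le> exp (- m * y\<^sup>2 / 2) * \<rho> y'" if "\<bar>y'\<bar> \<le> \<bar>y\<bar>" for y y'
  proof -
    have "exp (- m * y'\<^sup>2 / 2) * \<rho> y \<le> exp (- m * y'\<^sup>2 / 2) * (exp (- m * (y\<^sup>2 - y'\<^sup>2) / 2) * \<rho> y')"
      by (intro mult_left_mono elc_decay that) auto
    also have "\<dots> = exp (- m * y\<^sup>2 / 2) * \<rho> y'"
      by (simp add: field_simps flip: mult.assoc exp_add)
    finally show ?thesis .
  qed
  have le: "(y\<^sup>2 - y'\<^sup>2) * (?a y * ?c y' - ?a y' * ?c y) \<le> 0" for y y'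
  proof -
    have eq: "?a y * ?c y' - ?a y' * ?c y = (normal_density x 1 y * normal_density x 1 y')
        * (exp (- m * y'\<^sup>2 / 2) * \<rho> y - exp (- m * y\<^sup>2 / 2) * \<rho> y')"
      by (simp add: algebra_simps)
    show ?thesis
    proof (cases "\<bar>y'\<bar> \<le> \<bar>y\<bar>")
      case True
      hence "y'\<^sup>2 \<le> y\<^sup>2" by (simp add: abs_le_square_iff)
      thus ?thesis unfolding eq using decay[OF True]
        by (intro mult_nonneg_nonpos mult_nonneg_nonpos2) auto
    next
      case False
      hence F: "\<bar>y\<bar> \<le> \<bar>y'\<bar>" by simp
      hence "y\<^sup>2 \<le> y'\<^sup>2" by (simp add: abs_le_square_iff)
      thus ?thesis unfolding eq using decay[OF F]
        by (intro mult_nonpos_nonneg mult_nonneg_nonneg) auto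
    qed
  qed
  have c1: "has_bochner_integral lborel ?c (?K * 1)"
    unfolding c using normal_moment_even[OF \<sigma>(1), of ?\<mu> 0]
    by (intro has_bochner_integral_mult_right) simp
  have c2: "has_bochner_integral lborel (\<lambda>y. y\<^sup>2 * ?c y) (?K * (?\<sigma>\<^sup>2 + ?\<mu>\<^sup>2))"
    unfolding c using has_bochner_integral_mult_right[OF moments, of ?K] by (simp add: mult_ac)
  have b: "bounded_borel (\<lambda>y. \<rho> y * y\<^sup>2)"
    by (rule bounded_borel_elc_quadratic[where A = 0 and B = 1]) auto
  have "(\<integral>y. y\<^sup>2 * ?a y \<partial>lborel) * (\<integral>y. ?c y \<partial>lborel)
      \<le> (\<integral>y. y\<^sup>2 * ?c y \<partial>lborel) * (\<integral>y. ?a y \<partial>lborel)"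
    using integrable_bounded_borel_normal[OF bounded_borel_elc, of x]
      integrable_bounded_borel_normal[OF b, of x] c1 c2
    by (intro chebyshev_integral le) (auto simp: mult_ac has_bochner_integral_iff)
  hence "heat (\<lambda>y. \<rho> y * y\<^sup>2) x * ?K \<le> (?K * (?\<sigma>\<^sup>2 + ?\<mu>\<^sup>2)) * heat \<rho> x"
    unfolding has_bochner_integral_integral_eq[OF c1] has_bochner_integral_integral_eq[OF c2]
    by (simp add: heat_def mult_ac)
  hence "?K * heat (\<lambda>y. \<rho> y * y\<^sup>2) x \<le> ?K * ((?\<sigma>\<^sup>2 + ?\<mu>\<^sup>2) * heat \<rho> x)"
    by (simp add: mult_ac)
  moreover have "?K > 0" using m by simp
  ultimately show ?thesis unfolding \<sigma>(2) by (simp only: mult_le_cancel_left_pos)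
qed

end

section \<open>Contraction of odd Lipschitz observables, and powers of weights\<close>

lemma odd_mono_lipschitz_bound:
  assumes "odd_mono_lipschitz L f"
  shows "\<bar>f y\<bar> \<le> L * \<bar>y\<bar>"
proof -
  have "f (- 0) = - f 0" using assms unfolding odd_mono_lipschitz_def by blast
  hence f0: "f 0 = 0" by simp
  have pos: "0 \<le> f y \<and> f y \<le> L * y" if "0 \<le> y" for y
    using assms that f0 unfolding odd_mono_lipschitz_def by (metis add_0 diff_zero)
  have "f (- y) = - f y" using assms unfolding odd_mono_lipschitz_def by blast
  thus ?thesis using pos[of y] pos[of "- y"] by (cases "0 \<le> y") auto
qed

lemma odd_mono_lipschitz_nonneg:
  assumes "odd_mono_lipschitz L f"
  shows "0 \<le> L"
  using odd_mono_lipschitz_bound[OF assms, of 1] by simp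

lemma odd_mono_lipschitz_mono: "odd_mono_lipschitz L f \<Longrightarrow> mono f"
  by (auto simp: odd_mono_lipschitz_def intro: monoI)

lemma odd_mono_lipschitz_measurable:
  "odd_mono_lipschitz L f \<Longrightarrow> f \<in> borel_measurable borel"
  by (intro borel_measurable_mono odd_mono_lipschitz_mono)

lemma bounded_borel_elc_lipschitz:
  assumes lc: "even_log_concave m \<rho>" "m > 0" and f: "odd_mono_lipschitz L f"
  shows "bounded_borel (\<lambda>y. \<rho> y * f y)"
proof (rule bounded_borel_elc_quadratic[OF lc])
  show "f \<in> borel_measurable borel" by (rule odd_mono_lipschitz_measurable[OF f])
  show L: "0 \<le> L" "0 \<le> L" using odd_mono_lipschitz_nonneg[OF f] by auto
  fix y :: real
  have "\<bar>y\<bar> \<le> 1 + y\<^sup>2"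
  proof -
    have "0 \<le> (\<bar>y\<bar> - 1)\<^sup>2" "0 \<le> y\<^sup>2" by auto
    thus ?thesis unfolding power2_diff by simp
  qed
  hence "L * \<bar>y\<bar> \<le> L * (1 + y\<^sup>2)" using L by (intro mult_left_mono) auto
  thus "\<bar>f y\<bar> \<le> L + L * y\<^sup>2"
    using odd_mono_lipschitz_bound[OF f, of y] by (simp add: distrib_left)
qed

lemma odd_mono_lipschitz_mult_bound:
  assumes f: "odd_mono_lipschitz L f" and g: "odd_mono_lipschitz L' g"
  shows "\<bar>f y * g y\<bar> \<le> L * L' * y\<^sup>2"
proof -
  have "\<bar>f y * g y\<bar> \<le> (L * \<bar>y\<bar>) * (L' * \<bar>y\<bar>)"
    unfolding abs_mult using odd_mono_lipschitz_bound[OF f, of y] odd_mono_lipschitz_bound[OF g, of y]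
    by (intro mult_mono) auto
  thus ?thesis by (simp add: power2_eq_square mult_ac)
qed

text \<open>The law tilted towards \<open>y\<close> is dominated by the law tilted towards
  \<open>x\<close> translated by \<open>(y - x) / (1 + m)\<close>, and a translation by
  \<open>\<delta>\<close> changes \<open>f\<close> by at most \<open>L * \<delta>\<close>. Oddness
  and monotonicity pass through by reflection and by the monotone likelihood ratio.\<close>

lemma odd_mono_lipschitz_tilted_mean:
  assumes lc: "even_log_concave m \<rho>" "m > 0" and f: "odd_mono_lipschitz L f"
  shows "odd_mono_lipschitz (L / (1 + m)) (tilted_mean \<rho> f)"
  unfolding odd_mono_lipschitz_def
proof (intro conjI allI impI)
  note b = bounded_borel_elc_lipschitz[OF lc f]
  note b\<rho> = bounded_borel_elc[OF lc]
  note pos = heat_elc_pos[OF lc]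
  have odd: "f (- x) = - f x" for x using f by (simp add: odd_mono_lipschitz_def)
  show "tilted_mean \<rho> f (- x) = - tilted_mean \<rho> f x" for x
    by (simp add: tilted_mean_def heat_elc_even[OF lc] heat_reflect elc_even[OF lc] odd)
       (simp add: heat_def)
  fix x y :: real
  assume xy: "x \<le> y"
  show "tilted_mean \<rho> f x \<le> tilted_mean \<rho> f y"
    using heat_elc_mono[OF lc xy odd_mono_lipschitz_mono[OF f] b] pos[of x] pos[of y]
    by (simp add: tilted_mean_def divide_simps)
  define \<delta> where "\<delta> = (y - x) / (1 + m)"
  have \<delta>0: "0 \<le> \<delta>" using xy lc by (simp add: \<delta>_def)
  have [measurable]: "f \<in> borel_measurable borel" by (rule odd_mono_lipschitz_measurable[OF f])
  have [measurable]: "\<rho> \<in> borel_measurable borel" using elc_measurable[OF lc] .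
  have fd: "f z \<le> f (z + \<delta>)" "f (z + \<delta>) \<le> f z + L * \<delta>" for z
  proof -
    have "f z \<le> f (z + \<delta>) \<and> f (z + \<delta>) \<le> f z + L * (z + \<delta> - z)"
      using f \<delta>0 unfolding odd_mono_lipschitz_def by (metis le_add_same_cancel1)
    thus "f z \<le> f (z + \<delta>)" "f (z + \<delta>) \<le> f z + L * \<delta>" by auto
  qed
  note i1 = integrable_bounded_borel_normal[OF b]
  note i0 = integrable_bounded_borel_normal[OF b\<rho>]
  \<comment> \<open>The shifted observable need not be odd; its integrability is obtained from that
    of \<open>f\<close> by adding the bounded increment.\<close>
  have "bounded_borel (\<lambda>z. \<rho> z * (f (z + \<delta>) - f z))"
    by (rule bounded_borel_elc_quadratic[OF lc, where A = "L * \<delta>" and B = 0])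
       (use fd odd_mono_lipschitz_nonneg[OF f] \<delta>0 in
        \<open>auto simp: abs_of_nonneg diff_le_eq add.commute\<close>)
  note i3 = integrable_bounded_borel_normal[OF this]
  have i2: "integrable lborel (\<lambda>z. \<rho> z * f (z + \<delta>) * normal_density x 1 z)" for x
    using Bochner_Integration.integrable_add[OF i1[of x] i3[of x]] by (simp add: algebra_simps)
  have "heat (\<lambda>z. \<rho> z * f z) y * heat \<rho> x \<le> heat (\<lambda>z. \<rho> z * f (z + \<delta>)) x * heat \<rho> y"
    by (rule heat_elc_dominated[OF lc xy odd_mono_lipschitz_mono[OF f] \<delta>_def i1 i2])
  also have "heat (\<lambda>z. \<rho> z * f (z + \<delta>)) x \<le> heat (\<lambda>z. \<rho> z * f z) x + L * \<delta> * heat \<rho> x"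
  proof -
    have "heat (\<lambda>z. \<rho> z * f (z + \<delta>)) x
        \<le> (\<integral>z. \<rho> z * f z * normal_density x 1 z + L * \<delta> * (\<rho> z * normal_density x 1 z) \<partial>lborel)"
      unfolding heat_def
    proof (intro integral_mono i2 Bochner_Integration.integrable_add i1 integrable_mult_right i0)
      fix z
      have "\<rho> z * normal_density x 1 z * f (z + \<delta>) \<le> \<rho> z * normal_density x 1 z * (f z + L * \<delta>)"
        using fd(2)[of z] elc_pos[OF lc, of z] by (intro mult_left_mono) auto
      thus "\<rho> z * f (z + \<delta>) * normal_density x 1 z
          \<le> \<rho> z * f z * normal_density x 1 z + L * \<delta> * (\<rho> z * normal_density x 1 z)"
        by (simp add: algebra_simps)
    qed
    also have "\<dots> = heat (\<lambda>z. \<rho> z * f z) x + L * \<delta> * heat \<rho> x"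
      using i1 i0 by (simp add: heat_def)
    finally show ?thesis .
  qed
  finally have "heat (\<lambda>z. \<rho> z * f z) y * heat \<rho> x
      \<le> (heat (\<lambda>z. \<rho> z * f z) x + L * \<delta> * heat \<rho> x) * heat \<rho> y"
    using pos[of y] by (simp add: mult_right_mono)
  hence "tilted_mean \<rho> f y \<le> tilted_mean \<rho> f x + L * \<delta>"
    using pos[of x] pos[of y] by (simp add: tilted_mean_def field_simps)
  thus "tilted_mean \<rho> f y \<le> tilted_mean \<rho> f x + L / (1 + m) * (y - x)"
    by (simp add: \<delta>_def)
qed

text \<open>The \<open>b\<close> children of a vertex contribute equal factors, so their potentials,
  and with them the convexity constants, add.\<close>

lemma even_log_concave_power:
  assumes "even_log_concave m \<rho>"
  shows "even_log_concave (real b * m) (\<lambda>x. \<rho> x ^ b)"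
  unfolding even_log_concave_def
proof (intro conjI allI impI)
  have \<rho>: "\<rho> \<in> borel_measurable borel" "\<And>x. 0 < \<rho> x" "\<And>x. \<rho> (- x) = \<rho> x"
    using assms unfolding even_log_concave_def by blast+
  show "(\<lambda>x. \<rho> x ^ b) \<in> borel_measurable borel" "0 < \<rho> x ^ b" "\<rho> (- x) ^ b = \<rho> x ^ b" for x
    using \<rho> by simp_all
  fix x x' t :: real
  assume "x \<le> x'" "0 \<le> t"
  hence "\<rho> (x' + t) * \<rho> x \<le> exp (- m * t * (x' - x)) * (\<rho> (x + t) * \<rho> x')"
    using assms unfolding even_log_concave_def by blast
  hence "(\<rho> (x' + t) * \<rho> x) ^ b \<le> (exp (- m * t * (x' - x)) * (\<rho> (x + t) * \<rho> x')) ^ b"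
    using \<rho>(2)[of "x' + t"] \<rho>(2)[of x] by (intro power_mono) auto
  thus "\<rho> (x' + t) ^ b * \<rho> x ^ b \<le> exp (- (real b * m) * t * (x' - x)) * (\<rho> (x + t) ^ b * \<rho> x' ^ b)"
    unfolding power_mult_distrib exp_of_nat_mult[symmetric] by (simp only: mult_ac mult_minus_left mult_minus_right)
qed

section \<open>The last generation of the tree\<close>

lemma leaves_0 [simp]: "leaves b 0 = {[]}"
  by (auto simp: leaves_def)

lemma snoc_in_leaves [simp]: "\<tau> @ [i] \<in> leaves b (Suc n) \<longleftrightarrow> \<tau> \<in> leaves b n \<and> i \<in> {1..b}"
  by (auto simp: leaves_def)

lemma leaves_SucE:
  assumes "\<sigma> \<in> leaves b (Suc n)"
  obtains \<tau> i where "\<sigma> = \<tau> @ [i]" "\<tau> \<in> leaves b n" "i \<in> {1..b}"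
proof -
  from assms have "\<sigma> \<noteq> []" by (auto simp: leaves_def)
  then obtain \<tau> i where "\<sigma> = \<tau> @ [i]" by (metis append_butlast_last_id)
  with assms that show thesis by simp
qed

lemma bij_betw_leaves_Suc:
  "bij_betw (\<lambda>(\<tau>, i). \<tau> @ [i]) (leaves b n \<times> {1..b}) (leaves b (Suc n))"
  unfolding bij_betw_def
  by (auto simp: inj_on_def image_iff elim!: leaves_SucE)

lemma prod_leaves_Suc:
  "(\<Prod>\<sigma>\<in>leaves b (Suc n). f \<sigma>) = (\<Prod>\<tau>\<in>leaves b n. \<Prod>i\<in>{1..b}. f (\<tau> @ [i]))"
  unfolding prod.cartesian_product prod.reindex_bij_betw[OF bij_betw_leaves_Suc, symmetric]
  by (simp add: case_prod_beta')

lemma tree_Suc: "tree b (Suc n) - {[]} = (tree b n - {[]}) \<union> leaves b (Suc n)"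
  by (auto simp: tree_def leaves_def atLeastAtMostSuc_conv)

lemma brw_value_Nil [simp]: "brw_value \<zeta> [] = 0"
  by (simp add: brw_value_def)

lemma brw_value_snoc: "brw_value \<zeta> (\<tau> @ [i]) = brw_value \<zeta> \<tau> + \<zeta> (\<tau> @ [i])"
proof -
  have "{\<tau>'. \<tau>' \<noteq> [] \<and> prefix \<tau>' (\<tau> @ [i])} = insert (\<tau> @ [i]) {\<tau>'. \<tau>' \<noteq> [] \<and> prefix \<tau>' \<tau>}"
    by (auto simp: prefix_snoc)
  moreover have "finite {\<tau>'. \<tau>' \<noteq> [] \<and> prefix \<tau>' \<tau>}"
    by (rule finite_subset[of _ "set (prefixes \<tau>)"]) auto
  ultimately show ?thesis
    by (simp add: brw_value_def)
qed

lemma brw_value_cong: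
  assumes "\<tau> \<in> leaves b n" "\<And>\<tau>'. \<tau>' \<in> tree b n - {[]} \<Longrightarrow> \<zeta> \<tau>' = \<zeta>' \<tau>'"
  shows "brw_value \<zeta> \<tau> = brw_value \<zeta>' \<tau>"
  unfolding brw_value_def using assms prefix_in_tree[OF assms(1)]
  by (intro sum.cong) auto

section \<open>Integrating out one generation\<close>

text \<open>One function per leaf lets weight and observable be carried together. The average is
  over increments, not endpoints, because the last increments are independent of all earlier
  ones.\<close>

definition leaf_average :: "nat \<Rightarrow> nat \<Rightarrow> (nat list \<Rightarrow> real \<Rightarrow> real) \<Rightarrow> real" where
  "leaf_average b n h = (\<integral>\<zeta>. (\<Prod>\<tau>\<in>leaves b n. h \<tau> (brw_value \<zeta> \<tau>)) \<partial>increments b n)"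

lemma integrable_leaf_product:
  assumes "\<And>\<tau>. \<tau> \<in> leaves b n \<Longrightarrow> bounded_borel (h \<tau>)"
  shows "integrable (increments b n) (\<lambda>\<zeta>. \<Prod>\<tau>\<in>leaves b n. h \<tau> (brw_value \<zeta> \<tau>))"
proof -
  interpret prob_space "increments b n" by (rule prob_space_increments)
  from assms have "\<forall>\<tau>\<in>leaves b n. \<exists>B. \<forall>x. \<bar>h \<tau> x\<bar> \<le> B"
    by (auto simp: bounded_borel_def)
  then obtain B where B: "\<And>\<tau> x. \<tau> \<in> leaves b n \<Longrightarrow> \<bar>h \<tau> x\<bar> \<le> B \<tau>" by metis
  show ?thesis
  proof (rule integrable_const_bound)
    show "AE \<zeta> in increments b n.
        norm (\<Prod>\<tau>\<in>leaves b n. h \<tau> (brw_value \<zeta> \<tau>)) \<le> (\<Prod>\<tau>\<in>leaves b n. B \<tau>)"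
      using B by (intro AE_I2) (auto simp: abs_prod intro!: prod_mono)
    show "(\<lambda>\<zeta>. \<Prod>\<tau>\<in>leaves b n. h \<tau> (brw_value \<zeta> \<tau>)) \<in> borel_measurable (increments b n)"
    proof (rule borel_measurable_prod)
      fix \<tau> assume \<tau>: "\<tau> \<in> leaves b n"
      hence "h \<tau> \<in> borel_measurable borel" using assms by (simp add: bounded_borel_def)
      thus "(\<lambda>\<zeta>. h \<tau> (brw_value \<zeta> \<tau>)) \<in> borel_measurable (increments b n)"
        by (rule measurable_compose[OF brw_value_measurable[OF \<tau>]])
    qed
  qed
qed

text \<open>Given the first \<open>n\<close> generations, the leaf values are independent Gaussians
  centred at the values of their parents, so the conditional mean of the product is a product of
  convolutions.\<close>

lemma leaf_average_Suc:
  assumes h: "\<And>\<sigma>. \<sigma> \<in> leaves b (Suc n) \<Longrightarrow> bounded_borel (h \<sigma>)"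
  shows "leaf_average b (Suc n) h = leaf_average b n (\<lambda>\<tau> x. \<Prod>i\<in>{1..b}. heat (h (\<tau> @ [i])) x)"
proof -
  let ?\<gamma> = "\<lambda>_ :: nat list. density lborel std_normal_density"
  interpret \<gamma>: prob_space "density lborel std_normal_density" by (rule prob_space_normal_density) simp
  interpret product_sigma_finite ?\<gamma> by standard
  let ?I = "tree b n - {[]}" and ?K = "leaves b (Suc n)"
  let ?F = "\<lambda>\<zeta>. \<Prod>\<sigma>\<in>?K. h \<sigma> (brw_value \<zeta> \<sigma>)"
  have disj: "?I \<inter> ?K = {}" by (auto simp: tree_def leaves_def)
  have int: "integrable (increments b (Suc n)) ?F"
    by (rule integrable_leaf_product[OF h])
  have "leaf_average b (Suc n) h = integral\<^sup>L (Pi\<^sub>M (?I \<union> ?K) ?\<gamma>) ?F"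
    by (simp add: leaf_average_def increments_def tree_Suc)
  \<comment> \<open>Fubini: \<open>x\<close> holds the increments of the first \<open>n\<close>
    generations, \<open>y\<close> those of the last.\<close>
  also have "\<dots> = (\<integral>x. (\<integral>y. ?F (merge ?I ?K (x, y)) \<partial>Pi\<^sub>M ?K ?\<gamma>) \<partial>Pi\<^sub>M ?I ?\<gamma>)"
    using int unfolding increments_def tree_Suc
    by (intro product_integral_fold disj) (auto simp: finite_tree finite_leaves)
  also have "\<dots> = (\<integral>x. (\<Prod>\<tau>\<in>leaves b n. \<Prod>i\<in>{1..b}. heat (h (\<tau> @ [i])) (brw_value x \<tau>)) \<partial>Pi\<^sub>M ?I ?\<gamma>)"
  proof (intro Bochner_Integration.integral_cong refl)
    fix x
    \<comment> \<open>The parent \<open>butlast \<sigma>\<close> has a value depending on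
      \<open>x\<close> alone, and each \<open>y \<sigma>\<close> enters a single factor, so the
      inner integral factorises.\<close>
    have "(\<integral>y. ?F (merge ?I ?K (x, y)) \<partial>Pi\<^sub>M ?K ?\<gamma>)
        = (\<integral>y. (\<Prod>\<sigma>\<in>?K. h \<sigma> (brw_value x (butlast \<sigma>) + y \<sigma>)) \<partial>Pi\<^sub>M ?K ?\<gamma>)"
    proof (intro Bochner_Integration.integral_cong refl prod.cong)
      fix y \<sigma> assume "\<sigma> \<in> ?K"
      then obtain \<tau> i where \<sigma>: "\<sigma> = \<tau> @ [i]" "\<tau> \<in> leaves b n" "i \<in> {1..b}" by (rule leaves_SucE)
      have "brw_value (merge ?I ?K (x, y)) \<tau> = brw_value x \<tau>"
        by (rule brw_value_cong[OF \<sigma>(2)]) (simp add: merge_def)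
      moreover have "merge ?I ?K (x, y) \<sigma> = y \<sigma>"
        using disj \<open>\<sigma> \<in> ?K\<close> by (auto simp: merge_def)
      ultimately show "h \<sigma> (brw_value (merge ?I ?K (x, y)) \<sigma>) = h \<sigma> (brw_value x (butlast \<sigma>) + y \<sigma>)"
        by (simp add: \<sigma>(1) brw_value_snoc)
    qed
    also have "\<dots> = (\<Prod>\<sigma>\<in>?K. \<integral>z. h \<sigma> (brw_value x (butlast \<sigma>) + z) \<partial>density lborel std_normal_density)"
    proof (rule product_integral_prod[OF finite_leaves])
      fix \<sigma> assume "\<sigma> \<in> ?K"
      from h[OF this] obtain B where [measurable]: "h \<sigma> \<in> borel_measurable borel"
        and B: "\<And>x. \<bar>h \<sigma> x\<bar> \<le> B" by (auto simp: bounded_borel_def)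
      show "integrable (density lborel std_normal_density) (\<lambda>z. h \<sigma> (brw_value x (butlast \<sigma>) + z))"
        by (rule \<gamma>.integrable_const_bound[where B = B]) (auto simp: B)
    qed
    also have "\<dots> = (\<Prod>\<sigma>\<in>?K. heat (h \<sigma>) (brw_value x (butlast \<sigma>)))"
      using h by (intro prod.cong refl heat_std_normal) (simp add: bounded_borel_def)
    finally show "(\<integral>y. ?F (merge ?I ?K (x, y)) \<partial>Pi\<^sub>M ?K ?\<gamma>)
        = (\<Prod>\<tau>\<in>leaves b n. \<Prod>i\<in>{1..b}. heat (h (\<tau> @ [i])) (brw_value x \<tau>))"
      by (simp add: prod_leaves_Suc)
  qed
  finally show ?thesis by (simp add: leaf_average_def increments_def)
qed

section \<open>Weighted averages of product observables and their recursion\<close>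

text \<open>Unnormalised: the expectation is the quotient by \<open>partition_fun\<close>.
  Restricting to products over leaves gives a form that survives integrating out a
  generation.\<close>

definition gibbs :: "nat \<Rightarrow> nat \<Rightarrow> (real \<Rightarrow> real) \<Rightarrow> (nat list \<Rightarrow> real \<Rightarrow> real) \<Rightarrow> real" where
  "gibbs b n \<rho> F = leaf_average b n (\<lambda>\<tau> x. \<rho> x * F \<tau> x)"

text \<open>Presents an observable of the single leaf \<open>\<sigma>\<close> as a product over all
  leaves; two marked leaves are described by a pointwise product.\<close>

definition at_leaf :: "nat list \<Rightarrow> (real \<Rightarrow> real) \<Rightarrow> nat list \<Rightarrow> real \<Rightarrow> real" where
  "at_leaf \<sigma> q \<tau> x = (if \<tau> = \<sigma> then q x else 1)"

definition partition_fun :: "nat \<Rightarrow> nat \<Rightarrow> (real \<Rightarrow> real) \<Rightarrow> real" where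
  "partition_fun b n \<rho> = gibbs b n \<rho> (\<lambda>_ _. 1)"

lemma tilted_mean_one:
  assumes "even_log_concave m \<rho>" "m > 0"
  shows "tilted_mean \<rho> (\<lambda>_. 1) x = 1"
  using heat_elc_pos[OF assms, of x] by (simp add: tilted_mean_def)

text \<open>Each child contributes \<open>heat \<rho>\<close> times a conditional mean. The first
  factors, being the same for all children, form the new weight; the conditional means form the new
  observable.\<close>

lemma gibbs_Suc:
  assumes lc: "even_log_concave m \<rho>" "m > 0"
    and F: "\<And>\<sigma>. \<sigma> \<in> leaves b (Suc n) \<Longrightarrow> bounded_borel (\<lambda>x. \<rho> x * F \<sigma> x)"
  shows "gibbs b (Suc n) \<rho> F
    = gibbs b n (\<lambda>x. heat \<rho> x ^ b) (\<lambda>\<tau> x. \<Prod>i\<in>{1..b}. tilted_mean \<rho> (F (\<tau> @ [i])) x)"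
proof -
  have "heat (\<lambda>y. \<rho> y * f y) x = heat \<rho> x * tilted_mean \<rho> f x" for f x
    using heat_elc_pos[OF lc, of x] by (simp add: tilted_mean_def)
  thus ?thesis unfolding gibbs_def
    by (subst leaf_average_Suc[OF F]) (simp_all add: prod.distrib)
qed

lemma partition_fun_Suc:
  assumes "even_log_concave m \<rho>" "m > 0"
  shows "partition_fun b (Suc n) \<rho> = partition_fun b n (\<lambda>x. heat \<rho> x ^ b)"
  unfolding partition_fun_def using bounded_borel_elc[OF assms]
  by (subst gibbs_Suc[OF assms]) (simp_all add: tilted_mean_one[OF assms])

lemma prod_at_leaf_snoc:
  assumes "i \<in> {1..b}"
  shows "(\<Prod>j\<in>{1..b}. at_leaf (\<tau> @ [i]) q (\<tau>' @ [j]) x) = at_leaf \<tau> q \<tau>' x"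
proof (cases "\<tau>' = \<tau>")
  case True
  have "(\<Prod>j\<in>{1..b}. at_leaf (\<tau> @ [i]) q (\<tau>' @ [j]) x) = (\<Prod>j\<in>{1..b}. if j = i then q x else 1)"
    by (simp add: at_leaf_def True)
  thus ?thesis using assms True by (simp add: at_leaf_def)
qed (simp add: at_leaf_def)

lemma bounded_borel_at_leaf:
  assumes "bounded_borel \<rho>" "bounded_borel (\<lambda>x. \<rho> x * q x)"
  shows "bounded_borel (\<lambda>x. \<rho> x * at_leaf \<sigma> q \<tau> x)"
  using assms by (cases "\<tau> = \<sigma>") (simp_all add: at_leaf_def)

text \<open>Unmarked leaves have conditional mean one, so the mark merely moves to the
  parent.\<close>

lemma gibbs_at_leaf_Suc:
  assumes lc: "even_log_concave m \<rho>" "m > 0" and q: "bounded_borel (\<lambda>x. \<rho> x * q x)"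
    and i: "i \<in> {1..b}"
  shows "gibbs b (Suc n) \<rho> (at_leaf (\<tau> @ [i]) q)
    = gibbs b n (\<lambda>x. heat \<rho> x ^ b) (at_leaf \<tau> (tilted_mean \<rho> q))"
proof -
  have T: "tilted_mean \<rho> (at_leaf (\<tau> @ [i]) q \<sigma>) x = at_leaf (\<tau> @ [i]) (tilted_mean \<rho> q) \<sigma> x" for \<sigma> x
    using tilted_mean_one[OF lc, of x] by (cases "\<sigma> = \<tau> @ [i]") (simp_all add: at_leaf_def[abs_def])
  show ?thesis
    by (subst gibbs_Suc[OF lc bounded_borel_at_leaf[OF bounded_borel_elc[OF lc] q]])
       (simp only: T prod_at_leaf_snoc[OF i])
qed

text \<open>Distinctness means that no leaf carries both marks, so the conditional means separate.
  The parents may coincide, and then both marks sit on one vertex.\<close>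

lemma gibbs_two_leaves_Suc:
  assumes lc: "even_log_concave m \<rho>" "m > 0"
    and f: "bounded_borel (\<lambda>x. \<rho> x * f x)" and g: "bounded_borel (\<lambda>x. \<rho> x * g x)"
    and i: "i \<in> {1..b}" and j: "j \<in> {1..b}" and ne: "\<tau>1 @ [i] \<noteq> \<tau>2 @ [j]"
  shows "gibbs b (Suc n) \<rho> (\<lambda>\<sigma> x. at_leaf (\<tau>1 @ [i]) f \<sigma> x * at_leaf (\<tau>2 @ [j]) g \<sigma> x)
    = gibbs b n (\<lambda>x. heat \<rho> x ^ b)
        (\<lambda>\<tau> x. at_leaf \<tau>1 (tilted_mean \<rho> f) \<tau> x * at_leaf \<tau>2 (tilted_mean \<rho> g) \<tau> x)"
proof -
  have "tilted_mean \<rho> (\<lambda>x. at_leaf \<sigma>1 f \<sigma> x * at_leaf \<sigma>2 g \<sigma> x) x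
      = at_leaf \<sigma>1 (tilted_mean \<rho> f) \<sigma> x * at_leaf \<sigma>2 (tilted_mean \<rho> g) \<sigma> x"
    if "\<sigma>1 \<noteq> \<sigma>2" for \<sigma>1 \<sigma>2 \<sigma> x
    using tilted_mean_one[OF lc, of x] that
    by (cases "\<sigma> = \<sigma>1"; cases "\<sigma> = \<sigma>2") (simp_all add: at_leaf_def[abs_def])
  note T = this[OF ne]
  have "bounded_borel (\<lambda>x. \<rho> x * (at_leaf \<sigma>1 f \<sigma> x * at_leaf \<sigma>2 g \<sigma> x))" if "\<sigma>1 \<noteq> \<sigma>2" for \<sigma>1 \<sigma>2 \<sigma>
    using f g bounded_borel_elc[OF lc] that
    by (cases "\<sigma> = \<sigma>1"; cases "\<sigma> = \<sigma>2") (simp_all add: at_leaf_def[abs_def])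
  note B = this[OF ne]
  show ?thesis
    by (subst gibbs_Suc[OF lc B])
       (simp_all only: T prod.distrib prod_at_leaf_snoc[OF i] prod_at_leaf_snoc[OF j])
qed

lemma prod_at_leaf:
  assumes "\<sigma> \<in> leaves b n"
  shows "(\<Prod>\<tau>\<in>leaves b n. at_leaf \<sigma> q \<tau> (\<phi> \<tau>)) = q (\<phi> \<sigma>)"
proof -
  have "(\<Prod>\<tau>\<in>leaves b n. at_leaf \<sigma> q \<tau> (\<phi> \<tau>)) = (\<Prod>\<tau>\<in>leaves b n. if \<tau> = \<sigma> then q (\<phi> \<tau>) else 1)"
    by (simp add: at_leaf_def)
  thus ?thesis using assms by (simp add: finite_leaves)
qed

text \<open>Positive weights make the average monotone. This leads from conditional second moments
  and from products of Lipschitz functions back to the observables \<open>1\<close> and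
  \<open>x\<^sup>2\<close>.\<close>

lemma gibbs_at_leaf_bound:
  assumes lc: "even_log_concave m \<rho>" "m > 0"
    and q: "q \<in> borel_measurable borel" "\<And>x. \<bar>q x\<bar> \<le> A + B * x\<^sup>2" "0 \<le> A" "0 \<le> B"
    and \<sigma>: "\<sigma> \<in> leaves b n"
  shows "\<bar>gibbs b n \<rho> (at_leaf \<sigma> q)\<bar>
    \<le> A * partition_fun b n \<rho> + B * gibbs b n \<rho> (at_leaf \<sigma> (\<lambda>x. x\<^sup>2))"
proof -
  let ?W = "\<lambda>\<zeta>. \<Prod>\<tau>\<in>leaves b n. \<rho> (brw_value \<zeta> \<tau>)"
  have eq: "(\<Prod>\<tau>\<in>leaves b n. \<rho> (brw_value \<zeta> \<tau>) * at_leaf \<sigma> q \<tau> (brw_value \<zeta> \<tau>))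
      = ?W \<zeta> * q (brw_value \<zeta> \<sigma>)" for q \<zeta>
    using prod_at_leaf[OF \<sigma>, of q "brw_value \<zeta>"] by (simp add: prod.distrib)
  have g: "gibbs b n \<rho> (at_leaf \<sigma> q) = (\<integral>\<zeta>. ?W \<zeta> * q (brw_value \<zeta> \<sigma>) \<partial>increments b n)" for q
    by (simp add: gibbs_def leaf_average_def eq)
  have int: "integrable (increments b n) (\<lambda>\<zeta>. ?W \<zeta> * q (brw_value \<zeta> \<sigma>))"
    if "bounded_borel (\<lambda>x. \<rho> x * q x)" for q
    using integrable_leaf_product[where h = "\<lambda>\<tau> x. \<rho> x * at_leaf \<sigma> q \<tau> x" and b = b and n = n,
        OF bounded_borel_at_leaf[OF bounded_borel_elc[OF lc] that]]
    by (simp add: eq)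
  have i0: "integrable (increments b n) ?W"
    using integrable_leaf_product[where h = "\<lambda>_. \<rho>"] bounded_borel_elc[OF lc] by simp
  have i1: "integrable (increments b n) (\<lambda>\<zeta>. ?W \<zeta> * q (brw_value \<zeta> \<sigma>))"
    by (intro int bounded_borel_elc_quadratic[OF lc q])
  have i2: "integrable (increments b n) (\<lambda>\<zeta>. ?W \<zeta> * (brw_value \<zeta> \<sigma>)\<^sup>2)"
    using int[OF bounded_borel_elc_quadratic[OF lc, of "\<lambda>x. x\<^sup>2" 0 1]] by simp
  have W: "0 \<le> ?W \<zeta>" for \<zeta>
    using elc_pos[OF lc] by (intro prod_nonneg) (auto intro: less_imp_le)
  have "\<bar>gibbs b n \<rho> (at_leaf \<sigma> q)\<bar> \<le> (\<integral>\<zeta>. \<bar>?W \<zeta> * q (brw_value \<zeta> \<sigma>)\<bar> \<partial>increments b n)"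
    unfolding g by (rule integral_abs_bound)
  also have "\<dots> \<le> (\<integral>\<zeta>. A * ?W \<zeta> + B * (?W \<zeta> * (brw_value \<zeta> \<sigma>)\<^sup>2) \<partial>increments b n)"
  proof (intro integral_mono integrable_abs i1 Bochner_Integration.integrable_add integrable_mult_right i0 i2)
    fix \<zeta>
    have "?W \<zeta> * \<bar>q (brw_value \<zeta> \<sigma>)\<bar> \<le> ?W \<zeta> * (A + B * (brw_value \<zeta> \<sigma>)\<^sup>2)"
      by (intro mult_left_mono q W)
    thus "\<bar>?W \<zeta> * q (brw_value \<zeta> \<sigma>)\<bar> \<le> A * ?W \<zeta> + B * (?W \<zeta> * (brw_value \<zeta> \<sigma>)\<^sup>2)"
      using W[of \<zeta>] by (simp add: abs_mult algebra_simps)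
  qed
  also have "\<dots> = A * partition_fun b n \<rho> + B * gibbs b n \<rho> (at_leaf \<sigma> (\<lambda>x. x\<^sup>2))"
    unfolding g using i0 i2 by (simp add: partition_fun_def gibbs_def leaf_average_def)
  finally show ?thesis .
qed

section \<open>Second-moment and two-leaf bounds by induction on the depth\<close>

lemma partition_fun_pos:
  assumes "even_log_concave m \<rho>" "m > 0" "0 < b"
  shows "0 < partition_fun b n \<rho>"
  using assms
proof (induction n arbitrary: \<rho> m)
  case 0
  interpret prob_space "increments b 0" by (rule prob_space_increments)
  show ?case using elc_pos[OF 0(1,2)] by (simp add: partition_fun_def gibbs_def leaf_average_def prob_space)
next
  case (Suc n)
  have "even_log_concave (real b * (m / (1 + m))) (\<lambda>x. heat \<rho> x ^ b)"
    by (intro even_log_concave_power even_log_concave_heat Suc.prems)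
  from Suc.IH[OF this] show ?case
    using Suc.prems by (simp add: partition_fun_Suc[OF Suc.prems(1,2)])
qed

text \<open>Below \<open>b - 1\<close>, the fixed point of \<open>m \<mapsto> b m / (1 + m)\<close>, the convexity constant of the
  effective potential increases from one generation to the next.\<close>

lemma effective_mass:
  fixes m b :: real
  assumes "0 < m" "m \<le> b - 1"
  shows "m \<le> b * (m / (1 + m))" "b * (m / (1 + m)) \<le> b - 1"
  using assms mult_left_mono[of "1 + m" b m] by (simp_all add: field_simps)

text \<open>Given its parent value \<open>x\<close>, a leaf has second moment at most
  \<open>1 / (1 + m) + (x / (1 + m))\<^sup>2\<close>, and the parent is covered by induction. The
  constant \<open>m\<close> changes with the generation, so the bound uses a common lower bound
  \<open>m0\<close>.\<close>

lemma gibbs_second_moment: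
  assumes "even_log_concave m \<rho>" "0 < m0" "m0 \<le> m" "m \<le> real b - 1" "\<sigma> \<in> leaves b n"
  shows "gibbs b n \<rho> (at_leaf \<sigma> (\<lambda>x. x\<^sup>2)) \<le> 1 / m0 * partition_fun b n \<rho>"
  using assms
proof (induction n arbitrary: \<rho> m \<sigma>)
  case 0
  \<comment> \<open>At depth zero the only leaf is the root, whose value is 0.\<close>
  have "gibbs b 0 \<rho> (at_leaf \<sigma> (\<lambda>x. x\<^sup>2)) = 0"
    using 0 by (simp add: gibbs_def leaf_average_def at_leaf_def)
  moreover have "0 < partition_fun b 0 \<rho>" using 0 by (intro partition_fun_pos[OF 0(1)]) auto
  ultimately show ?case using 0 by simp
next
  case (Suc n)
  from Suc.prems have m: "m > 0" "0 < 1 + m" by auto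
  note lc = Suc.prems(1) m(1)
  let ?\<rho> = "\<lambda>x. heat \<rho> x ^ b" and ?m = "real b * (m / (1 + m))"
  from \<open>\<sigma> \<in> leaves b (Suc n)\<close> obtain \<tau> i where \<sigma>: "\<sigma> = \<tau> @ [i]" "\<tau> \<in> leaves b n" "i \<in> {1..b}"
    by (rule leaves_SucE)
  have lc': "even_log_concave ?m ?\<rho>" by (intro even_log_concave_power even_log_concave_heat lc)
  have m': "m0 \<le> ?m" "?m \<le> real b - 1" "0 < ?m"
    using effective_mass[OF m(1) Suc.prems(4)] Suc.prems by auto
  let ?Z = "partition_fun b n ?\<rho>"
  have Z: "0 < ?Z" using Suc.prems m' by (intro partition_fun_pos[OF lc']) auto
  have bb: "bounded_borel (\<lambda>x. \<rho> x * x\<^sup>2)"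
    by (rule bounded_borel_elc_quadratic[OF lc, where A = 0 and B = 1]) auto
  let ?T = "tilted_mean \<rho> (\<lambda>x. x\<^sup>2)"
  have T: "\<bar>?T x\<bar> \<le> 1 / (1 + m) + (1 / (1 + m)\<^sup>2) * x\<^sup>2" for x
  proof -
    have "0 \<le> heat (\<lambda>y. \<rho> y * y\<^sup>2) x"
      unfolding heat_def using elc_pos[OF lc]
      by (intro Bochner_Integration.integral_nonneg mult_nonneg_nonneg) (auto intro: less_imp_le)
    hence "\<bar>?T x\<bar> = heat (\<lambda>y. \<rho> y * y\<^sup>2) x / heat \<rho> x"
      using heat_elc_pos[OF lc, of x] by (simp add: tilted_mean_def)
    also have "\<dots> \<le> 1 / (1 + m) + (x / (1 + m))\<^sup>2"
      using heat_elc_second_moment[OF lc, of x] heat_elc_pos[OF lc, of x]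
      by (simp add: divide_le_eq)
    finally show ?thesis by (simp add: power_divide)
  qed
  have Tm: "?T \<in> borel_measurable borel"
    unfolding tilted_mean_def using bounded_borel_heat[OF bb] bounded_borel_heat[OF bounded_borel_elc[OF lc]]
    by (intro borel_measurable_divide) (auto simp: bounded_borel_def)
  have "gibbs b (Suc n) \<rho> (at_leaf \<sigma> (\<lambda>x. x\<^sup>2)) = gibbs b n ?\<rho> (at_leaf \<tau> ?T)"
    unfolding \<sigma>(1) by (rule gibbs_at_leaf_Suc[OF lc bb \<sigma>(3)])
  also have "\<dots> \<le> \<bar>gibbs b n ?\<rho> (at_leaf \<tau> ?T)\<bar>" by simp
  also have "\<dots> \<le> 1 / (1 + m) * ?Z + (1 / (1 + m)\<^sup>2) * gibbs b n ?\<rho> (at_leaf \<tau> (\<lambda>x. x\<^sup>2))"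
    using m by (intro gibbs_at_leaf_bound[OF lc' m'(3) Tm T] \<sigma>) auto
  also have "\<dots> \<le> 1 / (1 + m) * ?Z + (1 / (1 + m)\<^sup>2) * (1 / m0 * ?Z)"
    using Suc.IH[OF lc' Suc.prems(2) m'(1,2) \<sigma>(2)] m by (intro add_mono mult_left_mono) auto
  also have "\<dots> = (1 / (1 + m) + 1 / ((1 + m)\<^sup>2 * m0)) * ?Z" by (simp add: distrib_right)
  also have "\<dots> \<le> 1 / m0 * ?Z"
  proof (intro mult_right_mono)
    have "m0 * (1 + m) \<le> m * (1 + m)" using Suc.prems m by (intro mult_right_mono) auto
    \<comment> \<open>This inequality is what makes \<open>1 / m0\<close> stable under the
      recursion; it follows from \<open>m0 \<le> m\<close>.\<close>
    hence "m0 * (1 + m) + 1 \<le> (1 + m)\<^sup>2" using m by (simp add: power2_eq_square algebra_simps)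
    hence "(m0 * (1 + m) + 1) / ((1 + m)\<^sup>2 * m0) \<le> (1 + m)\<^sup>2 / ((1 + m)\<^sup>2 * m0)"
      using Suc.prems(2) by (intro divide_right_mono) auto
    also have "\<dots> = 1 / m0" using m by simp
    also have "(m0 * (1 + m) + 1) / ((1 + m)\<^sup>2 * m0) = 1 / (1 + m) + 1 / ((1 + m)\<^sup>2 * m0)"
      unfolding add_divide_distrib power2_eq_square using m(2) Suc.prems(2) by simp
    finally show "1 / (1 + m) + 1 / ((1 + m)\<^sup>2 * m0) \<le> 1 / m0" .
  qed (use Z in simp)
  finally show ?case by (simp add: partition_fun_Suc[OF lc])
qed

text \<open>Either \<open>xs\<close> and \<open>ys\<close> already differ, and by equal length the
  common prefix stops inside them, or they agree and the last letters differ.\<close>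

lemma longest_common_prefix_snoc:
  assumes "length xs = length ys" "xs @ [x] \<noteq> ys @ [y]"
  shows "longest_common_prefix (xs @ [x]) (ys @ [y]) = longest_common_prefix xs ys"
  using assms by (induction xs ys rule: list_induct2) auto

lemma longest_common_prefix_self: "longest_common_prefix xs xs = xs"
  by (induction xs) auto

lemma tree_dist_snoc:
  assumes "\<tau>1 \<in> leaves b n" "\<tau>2 \<in> leaves b n" "\<tau>1 @ [i] \<noteq> \<tau>2 @ [j]"
  shows "tree_dist (Suc n) (\<tau>1 @ [i]) (\<tau>2 @ [j]) = Suc (tree_dist n \<tau>1 \<tau>2)"
proof -
  have l: "length \<tau>1 = n" "length \<tau>2 = n" using assms by (auto simp: leaves_def)
  have "length (longest_common_prefix \<tau>1 \<tau>2) \<le> n"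
    using prefix_length_le[OF longest_common_prefix_prefix1[of \<tau>1 \<tau>2]] l by simp
  thus ?thesis using assms l by (simp add: tree_dist_def longest_common_prefix_snoc Suc_diff_le)
qed

text \<open>As long as the marks are apart, the bound is invariant under the recursion: both
  Lipschitz constants are divided by \<open>1 + m\<close>, the mass becomes
  \<open>b * m / (1 + m)\<close>, the distance drops by one, and \<open>1 / (1 + m)\<close> times
  the new \<open>1 / (m * b ^ d)\<close> is the old one. Once the marks meet, the second moment
  takes over.\<close>

lemma gibbs_two_leaves_bound:
  assumes "even_log_concave m \<rho>" "0 < m0" "m0 \<le> m" "m \<le> real b - 1"
    and "odd_mono_lipschitz L1 f" "odd_mono_lipschitz L2 g" "\<sigma>1 \<in> leaves b n" "\<sigma>2 \<in> leaves b n"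
  shows "\<bar>gibbs b n \<rho> (\<lambda>\<tau> x. at_leaf \<sigma>1 f \<tau> x * at_leaf \<sigma>2 g \<tau> x)\<bar>
    \<le> L1 * L2 * ((real b - 1) / (m * real b ^ tree_dist n \<sigma>1 \<sigma>2))\<^sup>2 * (1 / m0 * partition_fun b n \<rho>)"
proof -
  \<comment> \<open>Coinciding marks, for arbitrary depth, weight and constants, since the induction
    meets this case with data changed by earlier steps.\<close>
  have equal: "\<bar>gibbs b n \<rho> (\<lambda>\<tau> x. at_leaf \<sigma> f \<tau> x * at_leaf \<sigma> g \<tau> x)\<bar>
      \<le> L1 * L2 * ((real b - 1) / (m * real b ^ tree_dist n \<sigma> \<sigma>))\<^sup>2 * (1 / m0 * partition_fun b n \<rho>)"
    if lc: "even_log_concave m \<rho>" "0 < m" and mm: "m0 \<le> m" "m \<le> real b - 1"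
      and f: "odd_mono_lipschitz L1 f" and g: "odd_mono_lipschitz L2 g" and \<sigma>: "\<sigma> \<in> leaves b n"
    for n m \<rho> L1 L2 f g \<sigma>
  proof -
    have fg[measurable]: "f \<in> borel_measurable borel" "g \<in> borel_measurable borel"
      by (rule odd_mono_lipschitz_measurable[OF f], rule odd_mono_lipschitz_measurable[OF g])
    have L: "0 \<le> L1" "0 \<le> L2"
      by (rule odd_mono_lipschitz_nonneg[OF f], rule odd_mono_lipschitz_nonneg[OF g])
    have Z: "0 < partition_fun b n \<rho>" using mm lc by (intro partition_fun_pos[OF lc]) auto
    have d: "tree_dist n \<sigma> \<sigma> = 0" using \<sigma> by (simp add: tree_dist_def longest_common_prefix_self leaves_def)
    have "(\<lambda>\<tau> x. at_leaf \<sigma> f \<tau> x * at_leaf \<sigma> g \<tau> x) = at_leaf \<sigma> (\<lambda>x. f x * g x)"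
      by (auto simp: at_leaf_def fun_eq_iff)
    hence "\<bar>gibbs b n \<rho> (\<lambda>\<tau> x. at_leaf \<sigma> f \<tau> x * at_leaf \<sigma> g \<tau> x)\<bar>
        \<le> 0 * partition_fun b n \<rho> + L1 * L2 * gibbs b n \<rho> (at_leaf \<sigma> (\<lambda>x. x\<^sup>2))"
      using odd_mono_lipschitz_mult_bound[OF f g] L
      by (simp only:) (intro gibbs_at_leaf_bound[OF lc] \<sigma>, auto)
    also have "\<dots> \<le> L1 * L2 * (1 / m0 * partition_fun b n \<rho>)"
      unfolding mult_zero_left add_0 using L
      by (intro mult_left_mono gibbs_second_moment[OF lc(1) \<open>0 < m0\<close> mm \<sigma>]) simp
    also have "\<dots> \<le> L1 * L2 * ((real b - 1) / m)\<^sup>2 * (1 / m0 * partition_fun b n \<rho>)"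
    proof -
      \<comment> \<open>The numerator \<open>b - 1\<close> is an upper bound for the mass at every
        generation, so that the telescoped factor can be inserted when the marks meet.\<close>
      have "1 \<le> ((real b - 1) / m)\<^sup>2" using mm lc by (intro one_le_power) simp
      hence "L1 * L2 * 1 \<le> L1 * L2 * ((real b - 1) / m)\<^sup>2" using L by (intro mult_left_mono) auto
      from mult_right_mono[OF this, of "1 / m0 * partition_fun b n \<rho>"] show ?thesis
        using Z \<open>0 < m0\<close> by simp
    qed
    finally show ?thesis by (simp add: d)
  qed
  show ?thesis
    using assms
  proof (induction n arbitrary: \<rho> m f g L1 L2 \<sigma>1 \<sigma>2)
    case 0
    thus ?case using equal[of m \<rho> L1 f L2 g "[]" 0] by simp
  next
    case (Suc n)
    from Suc.prems have m: "m > 0" "0 < 1 + m" "0 < real b" by auto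
    note lc = Suc.prems(1) m(1)
    show ?case
    proof (cases "\<sigma>1 = \<sigma>2")
      case True
      thus ?thesis using Suc.prems m equal[of m \<rho> L1 f L2 g \<sigma>1 "Suc n"] by simp
    next
      case False
      let ?\<rho> = "\<lambda>x. heat \<rho> x ^ b" and ?m = "real b * (m / (1 + m))"
      from \<open>\<sigma>1 \<in> leaves b (Suc n)\<close> obtain \<tau>1 i where \<sigma>1: "\<sigma>1 = \<tau>1 @ [i]" "\<tau>1 \<in> leaves b n" "i \<in> {1..b}"
        by (rule leaves_SucE)
      from \<open>\<sigma>2 \<in> leaves b (Suc n)\<close> obtain \<tau>2 j where \<sigma>2: "\<sigma>2 = \<tau>2 @ [j]" "\<tau>2 \<in> leaves b n" "j \<in> {1..b}"
        by (rule leaves_SucE)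
      note ne = False[unfolded \<sigma>1(1) \<sigma>2(1)]
      have lc': "even_log_concave ?m ?\<rho>" by (intro even_log_concave_power even_log_concave_heat lc)
      have m': "m0 \<le> ?m" "?m \<le> real b - 1"
        using effective_mass[OF m(1) Suc.prems(4)] Suc.prems by auto
      have "\<bar>gibbs b (Suc n) \<rho> (\<lambda>\<tau> x. at_leaf \<sigma>1 f \<tau> x * at_leaf \<sigma>2 g \<tau> x)\<bar>
          = \<bar>gibbs b n ?\<rho> (\<lambda>\<tau> x. at_leaf \<tau>1 (tilted_mean \<rho> f) \<tau> x * at_leaf \<tau>2 (tilted_mean \<rho> g) \<tau> x)\<bar>"
        unfolding \<sigma>1(1) \<sigma>2(1)
        by (subst gibbs_two_leaves_Suc[OF lc _ _ \<sigma>1(3) \<sigma>2(3) ne])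
           (auto intro: bounded_borel_elc_lipschitz[OF lc] Suc.prems)
      also have "\<dots> \<le> (L1 / (1 + m)) * (L2 / (1 + m))
          * ((real b - 1) / (?m * real b ^ tree_dist n \<tau>1 \<tau>2))\<^sup>2 * (1 / m0 * partition_fun b n ?\<rho>)"
        by (intro Suc.IH lc' m' odd_mono_lipschitz_tilted_mean lc \<sigma>1 \<sigma>2 Suc.prems)
      also have "(L1 / (1 + m)) * (L2 / (1 + m)) * ((real b - 1) / (?m * real b ^ tree_dist n \<tau>1 \<tau>2))\<^sup>2
          = L1 * L2 * ((real b - 1) / (m * real b ^ tree_dist (Suc n) \<sigma>1 \<sigma>2))\<^sup>2"
        unfolding \<sigma>1(1) \<sigma>2(1) tree_dist_snoc[OF \<sigma>1(2) \<sigma>2(2) ne]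
        using m by (simp add: power2_eq_square divide_simps)
      finally show ?thesis by (simp add: partition_fun_Suc[OF lc])
    qed
  qed
qed

section \<open>Convexity of the cosh potential\<close>

lemma sinh_minus_id_mono:
  fixes x y :: real
  assumes "x \<le> y"
  shows "y - x \<le> sinh y - sinh x"
proof -
  have "sinh x - x \<le> sinh y - y"
    using assms
  proof (rule DERIV_nonneg_imp_nondecreasing)
    fix z :: real
    have "((\<lambda>z. sinh z - z) has_real_derivative (cosh z - 1)) (at z)"
      by (auto intro!: derivative_eq_intros)
    thus "\<exists>d. ((\<lambda>z. sinh z - z) has_real_derivative d) (at z) \<and> 0 \<le> d"
      using cosh_real_ge_1[of z] by (intro exI[of _ "cosh z - 1"]) auto
  qed
  thus ?thesis by simp
qed

text \<open>The discrete form of a second derivative at least \<open>s\<^sup>2\<close>. With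
  \<open>u = s * t / 2\<close>, the right side is
  \<open>2 * sinh u * (sinh (s * x' + u) - sinh (s * x + u))\<close>, and increments of
  \<open>sinh\<close> dominate those of the identity in both factors.\<close>

lemma cosh_second_difference:
  fixes s x x' t :: real
  assumes "x \<le> x'" "0 \<le> t" "0 \<le> s"
  shows "s\<^sup>2 * t * (x' - x)
    \<le> cosh (s * (x' + t)) + cosh (s * x) - cosh (s * (x + t)) - cosh (s * x')"
proof -
  define u where "u = s * t / 2"
  have diff: "cosh (s * (x + t)) - cosh (s * x) = 2 * (sinh u * sinh (s * x + u))" for x
  proof -
    have "s * (x + t) = (s * x + u) + u" "s * x = (s * x + u) - u" by (simp_all add: u_def field_simps)
    hence "cosh (s * (x + t)) = cosh ((s * x + u) + u)" "cosh (s * x) = cosh ((s * x + u) - u)"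
      by metis+
    thus ?thesis unfolding cosh_add[of "s * x + u" u] cosh_diff[of "s * x + u" u] by simp
  qed
  have sx: "s * x + u \<le> s * x' + u" using assms by (simp add: mult_left_mono)
  have "u * (s * x' - s * x) \<le> sinh u * (sinh (s * x' + u) - sinh (s * x + u))"
    using sinh_minus_id_mono[OF sx] sinh_minus_id_mono[of 0 u] sx assms
    by (intro mult_mono) (auto simp: u_def)
  moreover have "s\<^sup>2 * t * (x' - x) = 2 * (u * (s * x' - s * x))"
    by (simp add: u_def power2_eq_square field_simps)
  ultimately show ?thesis
    using diff[of x] diff[of x'] by (simp add: right_diff_distrib)
qed

lemma even_log_concave_cosh:
  fixes l \<beta> :: real
  assumes "0 < l" "0 < \<beta>" "m \<le> l * \<beta>"
  shows "even_log_concave m (\<lambda>x. exp (- (l * cosh (sqrt \<beta> * x))))"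
  unfolding even_log_concave_def
proof (intro conjI allI impI)
  show "(\<lambda>x. exp (- (l * cosh (sqrt \<beta> * x)))) \<in> borel_measurable borel"
    by (intro borel_measurable_continuous_onI continuous_intros)
  fix x x' t :: real
  assume *: "x \<le> x'" "0 \<le> t"
  have "m * (t * (x' - x)) \<le> (l * \<beta>) * (t * (x' - x))"
    using assms * by (intro mult_right_mono) auto
  also have "\<dots> = l * ((sqrt \<beta>)\<^sup>2 * t * (x' - x))" using assms by simp
  also have "\<dots> \<le> l * (cosh (sqrt \<beta> * (x' + t)) + cosh (sqrt \<beta> * x)
      - cosh (sqrt \<beta> * (x + t)) - cosh (sqrt \<beta> * x'))"
    using assms cosh_second_difference[OF *, of "sqrt \<beta>"] by (intro mult_left_mono) auto
  finally show "exp (- (l * cosh (sqrt \<beta> * (x' + t)))) * exp (- (l * cosh (sqrt \<beta> * x)))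
      \<le> exp (- m * t * (x' - x))
        * (exp (- (l * cosh (sqrt \<beta> * (x + t)))) * exp (- (l * cosh (sqrt \<beta> * x'))))"
    by (simp add: algebra_simps flip: exp_add)
qed auto

section \<open>Transfer to the tilted law and choice of constants\<close>

text \<open>Passes from an \<open>ennreal\<close> density over the endpoint law to real integrals
  over the increments. For equal leaves the two marks multiply to a square.\<close>

lemma tilted_law_cosh_two_point:
  fixes l \<beta> :: real
  assumes l: "0 < l" and \<beta>: "0 < \<beta>" and \<tau>: "\<tau>1 \<in> leaves b n" "\<tau>2 \<in> leaves b n"
  defines "\<rho> \<equiv> \<lambda>x. exp (- (l * cosh (sqrt \<beta> * x)))"
  shows "(\<integral>\<Phi>. \<Phi> \<tau>1 * \<Phi> \<tau>2 \<partial>tilted_law b n (cosh_potential l \<beta>))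
    = gibbs b n \<rho> (\<lambda>\<tau> x. at_leaf \<tau>1 (\<lambda>x. x) \<tau> x * at_leaf \<tau>2 (\<lambda>x. x) \<tau> x) / partition_fun b n \<rho>"
proof -
  let ?w = "boltzmann_weight b n (cosh_potential l \<beta>)"
  let ?W = "\<lambda>\<Phi>. \<Prod>\<tau>\<in>leaves b n. \<rho> (\<Phi> \<tau>)"
  let ?Z = "partition_fun b n \<rho>"
  interpret prob_space "brw_law b n" by (rule prob_space_brw_law)
  have w: "?w \<Phi> = ennreal (?W \<Phi>)" for \<Phi>
    unfolding boltzmann_weight_cosh \<rho>_def by (simp add: exp_sum finite_leaves flip: sum_negf)
  have lc: "even_log_concave (l * \<beta>) \<rho>" "0 < l * \<beta>"
    unfolding \<rho>_def using l \<beta> by (auto intro: even_log_concave_cosh)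
  have [measurable]: "\<rho> \<in> borel_measurable borel" using elc_measurable[OF lc] .
  have W[measurable]: "?W \<in> borel_measurable (brw_law b n)"
    by (intro borel_measurable_prod measurable_compose[OF component_measurable]) auto
  have W01: "0 \<le> ?W \<Phi>" "?W \<Phi> \<le> 1" for \<Phi>
    using l by (auto simp: \<rho>_def intro!: prod_nonneg prod_le_1)
  have val: "(\<integral>\<Phi>. F \<Phi> \<partial>brw_law b n)
      = (\<integral>\<zeta>. F (\<lambda>\<tau>\<in>leaves b n. brw_value \<zeta> \<tau>) \<partial>increments b n)"
    if "F \<in> borel_measurable (brw_law b n)" for F :: "(nat list \<Rightarrow> real) \<Rightarrow> real"
    using that unfolding brw_law_def
    by (subst integral_distr[OF brw_map_measurable]) (auto simp: brw_law_def)
  have iW: "integrable (brw_law b n) ?W"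
    using W01 W by (intro integrable_const_bound[where B = 1]) auto
  have Z: "(\<integral>\<Phi>. ?W \<Phi> \<partial>brw_law b n) = ?Z"
    by (subst val[OF W]) (simp add: partition_fun_def gibbs_def leaf_average_def)
  have nnZ: "(\<integral>\<^sup>+\<Phi>. ?w \<Phi> \<partial>brw_law b n) = ennreal ?Z"
    unfolding w using W01 by (subst nn_integral_eq_integral[OF iW]) (auto simp: Z)
  have Z0: "0 < ?Z"
    using partition_function_cosh(1)[OF l, of b n \<beta>] unfolding nnZ
    by (simp add: ennreal_eq_0_iff not_le)
  have F: "(\<lambda>\<Phi>. \<Phi> \<tau>1 * \<Phi> \<tau>2) \<in> borel_measurable (brw_law b n)"
    using \<tau> by (intro borel_measurable_times component_measurable)
  have "(\<integral>\<Phi>. \<Phi> \<tau>1 * \<Phi> \<tau>2 \<partial>tilted_law b n (cosh_potential l \<beta>))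
      = (\<integral>\<Phi>. \<Phi> \<tau>1 * \<Phi> \<tau>2 \<partial>density (brw_law b n) (\<lambda>\<Phi>. ennreal (?W \<Phi> / ?Z)))"
    unfolding tilted_law_def nnZ using Z0 W01 by (simp add: w divide_ennreal)
  also have "\<dots> = (\<integral>\<Phi>. (?W \<Phi> / ?Z) * (\<Phi> \<tau>1 * \<Phi> \<tau>2) \<partial>brw_law b n)"
    using Z0 W01 F by (subst integral_density) auto
  also have "\<dots> = (\<integral>\<Phi>. ?W \<Phi> * (\<Phi> \<tau>1 * \<Phi> \<tau>2) \<partial>brw_law b n) / ?Z"
    by (simp flip: integral_divide_zero)
  also have "(\<integral>\<Phi>. ?W \<Phi> * (\<Phi> \<tau>1 * \<Phi> \<tau>2) \<partial>brw_law b n)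
      = gibbs b n \<rho> (\<lambda>\<tau> x. at_leaf \<tau>1 (\<lambda>x. x) \<tau> x * at_leaf \<tau>2 (\<lambda>x. x) \<tau> x)"
    using prod_at_leaf[OF \<tau>(1), of "\<lambda>x. x"] prod_at_leaf[OF \<tau>(2), of "\<lambda>x. x"] \<tau>
    by (subst val) (use F W in \<open>auto simp: gibbs_def leaf_average_def prod.distrib\<close>)
  finally show ?thesis .
qed

theorem theorem1p5:
  fixes b :: nat
  assumes "b \<ge> 2"
  shows "\<exists>C c :: real. C > 0 \<and> c > 0 \<and>
    (\<forall>l \<beta> :: real. \<forall>n :: nat. \<forall>\<tau>1 \<tau>2.
       l > 0 \<longrightarrow> \<beta> > 0 \<longrightarrow> n \<ge> 1 \<longrightarrow> \<tau>1 \<in> leaves b n \<longrightarrow> \<tau>2 \<in> leaves b n \<longrightarrow>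
       \<bar>\<integral>\<Phi>. \<Phi> \<tau>1 * \<Phi> \<tau>2 \<partial>tilted_law b n (cosh_potential l \<beta>)\<bar>
         \<le> C * exp (- c * real (tree_dist n \<tau>1 \<tau>2) + C * log_plus (1 / (l * \<beta>))))"
proof -
  \<comment> \<open>The prefactor needs \<open>(b - 1)\<^sup>2\<close> and the exponent needs
    \<open>3\<close>, the power of \<open>1 / m\<close>; the sum serves both.\<close>
  define C where "C = (real b - 1)\<^sup>2 + 3"
  \<comment> \<open>Each of the two observables contributes a decay
    \<open>b ^ (- d)\<close>.\<close>
  define c where "c = 2 * ln (real b)"
  have C: "C \<ge> 3" "(real b - 1)\<^sup>2 \<le> C" by (simp_all add: C_def)
  have "\<bar>\<integral>\<Phi>. \<Phi> \<tau>1 * \<Phi> \<tau>2 \<partial>tilted_law b n (cosh_potential l \<beta>)\<bar>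
      \<le> C * exp (- c * real (tree_dist n \<tau>1 \<tau>2) + C * log_plus (1 / (l * \<beta>)))"
    if l: "0 < l" and \<beta>: "0 < \<beta>" and \<tau>: "\<tau>1 \<in> leaves b n" "\<tau>2 \<in> leaves b n" for l \<beta> n \<tau>1 \<tau>2
  proof -
    define d where "d = tree_dist n \<tau>1 \<tau>2"
    \<comment> \<open>The cap 1 ensures \<open>m \<le> b - 1\<close>, as \<open>b \<ge> 2\<close>,
      and makes \<open>1 / m\<close> equal to the exponential of \<open>log_plus\<close>.\<close>
    define m where "m = min (l * \<beta>) 1"
    define \<rho> where "\<rho> = (\<lambda>x. exp (- (l * cosh (sqrt \<beta> * x))))"
    define P where "P = log_plus (1 / (l * \<beta>))"
    have P0: "0 \<le> P" by (simp add: P_def log_plus_def)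
    have m: "0 < m" "m \<le> real b - 1" using l \<beta> assms by (auto simp: m_def)
    have mP: "1 / m = exp P"
    proof (cases "l * \<beta> \<le> 1")
      case True
      hence "0 \<le> ln (1 / (l * \<beta>))" using l \<beta> by (intro ln_ge_zero) (simp add: field_simps)
      hence "P = ln (1 / (l * \<beta>))" by (simp add: P_def log_plus_def)
      thus ?thesis using True l \<beta> by (simp add: m_def)
    next
      case False
      hence "ln (1 / (l * \<beta>)) \<le> 0" using l \<beta> by (subst ln_le_zero_iff) (auto simp: field_simps)
      thus ?thesis using False by (simp add: P_def log_plus_def m_def)
    qed
    have lc: "even_log_concave m \<rho>"
      unfolding \<rho>_def using l \<beta> by (intro even_log_concave_cosh) (auto simp: m_def)
    have Z: "0 < partition_fun b n \<rho>" using assms by (intro partition_fun_pos[OF lc m(1)]) auto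
    have id: "odd_mono_lipschitz 1 (\<lambda>x. x)" by (auto simp: odd_mono_lipschitz_def)
    have bd: "1 / real b ^ d = exp (- ln (real b) * real d)"
      using assms by (simp add: exp_minus exp_of_nat2_mult divide_inverse)
    have "\<bar>\<integral>\<Phi>. \<Phi> \<tau>1 * \<Phi> \<tau>2 \<partial>tilted_law b n (cosh_potential l \<beta>)\<bar>
        \<le> ((real b - 1) / (m * real b ^ d))\<^sup>2 * (1 / m)"
      using gibbs_two_leaves_bound[OF lc m(1) order_refl m(2) id id \<tau>] Z
      unfolding tilted_law_cosh_two_point[OF l \<beta> \<tau>] \<rho>_def[symmetric] d_def[symmetric]
      by (simp add: divide_le_eq)
    \<comment> \<open>Of the three powers of \<open>1 / m\<close>, two come from the telescoped
      factors and one from the second moment.\<close>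
    also have "\<dots> = (real b - 1)\<^sup>2 * ((1 / real b ^ d)\<^sup>2 * (1 / m) ^ 3)"
      by (simp add: power2_eq_square power3_eq_cube field_simps)
    also have "(1 / real b ^ d)\<^sup>2 * (1 / m) ^ 3 = exp (- c * real d + 3 * P)"
      unfolding mP bd by (simp add: c_def power2_eq_square power3_eq_cube algebra_simps flip: exp_add)
    also have "(real b - 1)\<^sup>2 * \<dots> \<le> C * exp (- c * real d + C * P)"
      using C P0 by (intro mult_mono) (auto intro: mult_right_mono)
    finally show ?thesis by (simp add: d_def P_def)
  qed
  moreover have "0 < C" "0 < c" using C assms by (auto simp: c_def)
  ultimately show ?thesis by blast
qed

end
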